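(* Let $d\ge2$. Then $(\mathcal P_2(\mathbb R^d),SW)$ is a complete metric space.
   Context: $\mathcal P_2(\mathbb R^d)$ is the set of Borel probability measures on $\mathbb R^d$ with finite second moment, $W$ the quadratic Wasserstein distance, $\sigma$ the uniform probability measure on $\mathbb S^{d-1}$. For $\theta\in\mathbb S^{d-1}$, $\hat\mu^\theta$ is the pushforward of $\mu$ under $x\mapsto x\cdot\theta$, and $SW^2(\mu,\nu)=\int_{\mathbb S^{d-1}}W^2(\hat\mu^\theta,\hat\nu^\theta)\,d\sigma(\theta)$. *)

theory Defs
  imports "HOL-Probability.Probability"
begin

definition P2 :: "'a::euclidean_space measure set" where
  "P2 = {\<mu>. prob_space \<mu> \<and> sets \<mu> = sets borel \<and> (\<integral>\<^sup>+ x. ennreal ((norm x)\<^sup>2) \<partial>\<mu>) < \<infinity>}"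

definition couplings :: "'a::euclidean_space measure \<Rightarrow> 'a measure \<Rightarrow> ('a \<times> 'a) measure set" where
  "couplings \<mu> \<nu> = {\<gamma>. prob_space \<gamma> \<and> sets \<gamma> = sets (borel \<Otimes>\<^sub>M borel) \<and>
     distr \<gamma> borel fst = \<mu> \<and> distr \<gamma> borel snd = \<nu>}"

text \<open>The infimum is finite for arguments in \<^const>\<open>P2\<close> (take the product coupling), so there
  the conversion to \<^typ>\<open>real\<close> loses nothing.\<close>

definition wasserstein2 :: "'a::euclidean_space measure \<Rightarrow> 'a measure \<Rightarrow> real" where
  "wasserstein2 \<mu> \<nu> =
     sqrt (enn2real (INF \<gamma> \<in> couplings \<mu> \<nu>. \<integral>\<^sup>+ (x, y). ennreal ((dist x y)\<^sup>2) \<partial>\<gamma>))"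

text \<open>The normalised surface measure of a set \<open>A\<close> of directions is the proportion of the volume of
  the unit ball lying in the cone over \<open>A\<close>; that is, it is the law of \<open>x / \<parallel>x\<parallel>\<close> for \<open>x\<close> uniform in
  the ball. It is represented as a Borel measure on the whole space, concentrated on the sphere
  (\<open>sgn 0 = 0\<close> concerns a null set only).\<close>

definition sphere_uniform :: "'a::euclidean_space measure" where
  "sphere_uniform = distr (uniform_measure lborel (ball 0 1)) borel sgn"

definition proj_measure :: "'a::euclidean_space \<Rightarrow> 'a measure \<Rightarrow> real measure" where
  "proj_measure \<theta> \<mu> = distr \<mu> borel (\<lambda>x. x \<bullet> \<theta>)"

text \<open>For \<open>\<mu>\<close> and \<open>\<nu>\<close> in \<^const>\<open>P2\<close> the integrand is continuous and bounded on the sphere, so the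
  Bochner integral does not fall back on its default value.\<close>

definition SW :: "'a::euclidean_space measure \<Rightarrow> 'a measure \<Rightarrow> real" where
  "SW \<mu> \<nu> = sqrt (LINT \<theta>:sphere 0 1|sphere_uniform.
     (wasserstein2 (proj_measure \<theta> \<mu>) (proj_measure \<theta> \<nu>))\<^sup>2)"

lemma prob_space_sphere_uniform: "prob_space (sphere_uniform :: 'a::euclidean_space measure)"
proof -
  have "emeasure lborel (ball (0::'a) 1) \<noteq> 0"
    using content_ball_pos[of 1 "0::'a"] by (auto simp: measure_def)
  moreover have "emeasure lborel (ball (0::'a) 1) \<noteq> \<infinity>"
    using emeasure_lborel_ball_finite[of "0::'a" 1] by simp
  ultimately show ?thesis
    unfolding sphere_uniform_def
    by (intro prob_space.prob_space_distr prob_space_uniform_measure) auto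
qed

lemma AE_sphere_uniform: "AE \<theta> in (sphere_uniform :: 'a::euclidean_space measure). \<theta> \<in> sphere 0 1"
proof -
  have "AE x in lborel. (x::'a) \<noteq> 0"
    by (rule AE_lborel_singleton)
  then have "AE x in uniform_measure lborel (ball (0::'a) 1). sgn x \<in> sphere 0 1"
    by (intro AE_uniform_measureI) (auto simp: norm_sgn)
  then show ?thesis
    unfolding sphere_uniform_def by (subst AE_distr_iff) auto
qed

text \<open>The sort \<open>wellorder\<close> comes from the change-of-variables library; the definition does not
  depend on it.\<close>

lemma sphere_uniform_rotation_invariant:
  fixes f :: "real ^ 'n::{finite,wellorder} \<Rightarrow> real ^ 'n::_"
  assumes f: "orthogonal_transformation f"
  shows "distr sphere_uniform borel f = sphere_uniform"
proof (rule measure_eqI)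
  fix A :: "(real ^ 'n::_) set" assume "A \<in> sets (distr sphere_uniform borel f)"
  then have A: "A \<in> sets borel" by simp
  have lin: "linear f" and nf: "\<And>x. norm (f x) = norm x"
    using f by (auto simp: orthogonal_transformation)
  have fm [measurable]: "f \<in> borel_measurable borel"
    using lin by (intro borel_measurable_continuous_onI linear_continuous_on linear_conv_bounded_linear[THEN iffD1])
  have sf: "f (sgn x) = sgn (f x)" for x
    by (simp add: sgn_div_norm nf linear_scale[OF lin])
  define C where "C = {x \<in> ball 0 1. sgn x \<in> A}"
  have C: "C \<in> sets borel" unfolding C_def using A by measurable
  have C': "f -` C = {x \<in> ball 0 1. sgn (f x) \<in> A}" by (auto simp: C_def nf)
  have mC': "f -` C \<in> sets borel" using measurable_sets[OF fm C] by simp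
  have im: "f ` (f -` C) = C" using orthogonal_transformation_surj[OF f] by (simp add: surj_image_vimage_eq)
  have "bounded (f -` C)" by (rule bounded_subset[of "ball 0 1"]) (auto simp: C')
  then have lm: "f -` C \<in> lmeasurable"
    using mC' by (intro bounded_set_imp_lmeasurable) auto
  have "measure lebesgue C = measure lebesgue (f -` C)"
    using measure_orthogonal_image[OF f lm] im by simp
  moreover have "bounded C" by (rule bounded_subset[of "ball 0 1"]) (auto simp: C_def)
  then have "C \<in> lmeasurable"
    using C by (intro bounded_set_imp_lmeasurable) auto
  ultimately have "emeasure lebesgue (f -` C) = emeasure lebesgue C"
    using lm by (metis emeasure_eq_measure2)
  then have eq: "emeasure lborel (f -` C) = emeasure lborel C"
    using C mC' by simp
  have U: "emeasure sphere_uniform B = emeasure lborel {x \<in> ball 0 1. sgn x \<in> B} / emeasure lborel (ball (0::real^'n::_) 1)"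
    if "B \<in> sets borel" for B :: "(real^'n::_) set"
    unfolding sphere_uniform_def using that
    by (subst emeasure_distr) (auto simp: Int_def vimage_def)
  have "emeasure (distr sphere_uniform borel f) A = emeasure sphere_uniform (f -` A)"
    using A by (subst emeasure_distr) (auto simp: sphere_uniform_def)
  also have "\<dots> = emeasure sphere_uniform A"
    using A measurable_sets[OF fm A] eq by (simp add: U C' C_def sf nf)
  finally show "emeasure (distr sphere_uniform borel f) A = emeasure sphere_uniform A" .
qed (simp add: sphere_uniform_def)

end

theory Submission
  imports Defs
begin

text \<open>On the line, Hoeffding's formula shows that the quantile coupling is optimal. It turns the
  squared Wasserstein distance into \<open>\<parallel>Q\<^sub>\<mu> - Q\<^sub>\<nu>\<parallel>\<^sup>2\<close> for the quantile functions, whence the triangle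
  inequality (Minkowski, on the line and then over the sphere), and into a double integral over the
  distribution functions, whence measurability in the direction and, by Fatou, lower semicontinuity
  under weak convergence.

  If \<open>SW \<mu> \<nu> = 0\<close> then almost all projections agree, so \<open>\<mu>\<close> and \<open>\<nu>\<close> give the same integral to
  all \<open>cos (\<xi> \<bullet> x + a)\<close>. These span an algebra, and an injective winding of \<open>\<real>\<^sup>d\<close> into a torus
  together with the Stone-Weierstrass theorem gives \<open>\<mu> = \<nu>\<close>.

  The average of \<open>(x \<bullet> \<theta>)\<^sup>2\<close> over the sphere dominates \<open>c \<parallel>x\<parallel>\<^sup>2\<close>, so a Cauchy sequence has bounded second
  moments. A space-filling curve carries Helly's and Skorohod's theorems from the line to \<open>\<real>\<^sup>d\<close> and
  yields a weak limit along a subsequence; lower semicontinuity of \<open>SW\<close> makes it the limit.\<close>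

subsection \<open>The quadratic Wasserstein distance on the line\<close>

text \<open>Both descriptions of the cost on the line are needed. Quantile functions place all laws
  in one \<open>L2\<close> space, so that no couplings have to be glued for the triangle inequality;
  but their dependence on the direction is awkward, whereas distribution functions of projections
  are jointly measurable in direction and level and converge off a countable set under weak
  convergence. The obstacle to compactness is that a curve filling the cube has no continuous
  inverse, and that the whole space corresponds only to the open cube. The way back is continuous
  only away from the faces; Fatou's lemma for the second moments shows that almost no path ends
  there. Convergence in \<open>SW\<close> is stronger than weak convergence, since it also controls
  second moments. Lower semicontinuity replaces a proof that these converge: its free argument runs
  through the Cauchy sequence itself.\<close>

definition quantile :: "real measure \<Rightarrow> real \<Rightarrow> real" where
  "quantile M u = Inf {x. u \<le> cdf M x}"

text \<open>The open interval excludes the levels at which the infimum in \<open>quantile\<close>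
  may be taken over an empty set or a set unbounded below.\<close>

abbreviation unit_lebesgue :: "real measure" where
  "unit_lebesgue \<equiv> restrict_space lborel {0<..<1}"

lemma prob_space_unit_lebesgue: "prob_space unit_lebesgue"
  by (auto simp: space_restrict_space emeasure_restrict_space intro!: prob_spaceI)

lemma quantile_le_iff:
  assumes "real_distribution M" "0 < u" "u < 1"
  shows "quantile M u \<le> x \<longleftrightarrow> u \<le> cdf M x"
proof -
  interpret cdf_distribution M unfolding cdf_distribution_def by fact
  show ?thesis
    unfolding quantile_def by (rule pseudoinverse[OF assms(2,3), symmetric])
qed

lemma measurable_quantile:
  assumes "real_distribution M"
  shows "quantile M \<in> borel_measurable unit_lebesgue"
proof -
  interpret cdf_distribution M unfolding cdf_distribution_def by fact
  have "(\<lambda>u. Inf {x. u \<le> cdf M x}) \<in> borel_measurable (restrict_space borel {0<..<1})"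
    by (rule measurable_CI)
  then show ?thesis
    unfolding quantile_def[abs_def] by (simp cong: measurable_cong_sets add: sets_restrict_space)
qed

lemma distr_quantile:
  assumes "real_distribution M"
  shows "distr unit_lebesgue borel (quantile M) = M"
proof -
  interpret cdf_distribution M unfolding cdf_distribution_def by fact
  show ?thesis unfolding quantile_def[abs_def] by (rule distr_I_eq_M)
qed

lemma nn_integral_triangle:
  fixes x y :: real
  shows "(\<integral>\<^sup>+s. \<integral>\<^sup>+t. (if x \<le> s \<and> s \<le> t \<and> t < y then 1 else 0) \<partial>lborel \<partial>lborel)
    = ennreal (if x < y then (y - x)\<^sup>2 / 2 else 0)"
proof -
  have "(\<integral>\<^sup>+t. (if x \<le> s \<and> s \<le> t \<and> t < y then 1 else 0) \<partial>lborel)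
      = ennreal (y - s) * indicator {x..y} s" for s
  proof (cases "x \<le> s")
    case True
    then have "(\<integral>\<^sup>+t. (if x \<le> s \<and> s \<le> t \<and> t < y then 1 else 0) \<partial>lborel)
        = (\<integral>\<^sup>+t. indicator {s..<y} t \<partial>lborel)"
      by (intro nn_integral_cong) (auto split: split_indicator)
    also have "\<dots> = emeasure lborel {s..<y}" by simp
    also have "\<dots> = ennreal (y - s) * indicator {x..y} s"
    proof (cases "s \<le> y")
      case True then show ?thesis using \<open>x \<le> s\<close> by simp
    next
      case False then show ?thesis by (simp add: ennreal_neg)
    qed
    finally show ?thesis .
  qed (auto split: split_indicator)
  then have "?thesis \<longleftrightarrow> (\<integral>\<^sup>+s. ennreal (y - s) * indicator {x..y} s \<partial>lborel)
      = ennreal (if x < y then (y - x)\<^sup>2 / 2 else 0)"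
    by simp
  moreover have "(\<integral>\<^sup>+s. ennreal (y - s) * indicator {x..y} s \<partial>lborel)
      = ennreal (if x < y then (y - x)\<^sup>2 / 2 else 0)"
  proof (cases "x \<le> y")
    case True
    have "(\<integral>\<^sup>+s. ennreal (y - s) * indicator {x..y} s \<partial>lborel)
        = ennreal (- ((y - y)\<^sup>2 / 2) - (- ((y - x)\<^sup>2 / 2)))"
      by (rule nn_integral_FTC_Icc)
        (auto intro!: derivative_eq_intros simp: True field_simps
          simp flip: has_real_derivative_iff_has_vector_derivative)
    then show ?thesis using True by auto
  next
    case False
    then show ?thesis by (auto split: split_indicator)
  qed
  ultimately show ?thesis by simp
qed

text \<open>The square is twice the area of the triangle cut out by \<open>s \<le> t\<close> between
  the smaller and the larger number, and at most one of the two indicators is nonzero. The half-open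
  form is chosen so that for random variables the conditions become \<open>X \<le> s\<close> and
  \<open>t < Y\<close>, which distribution functions can describe.\<close>

lemma square_diff_eq_nn_integral:
  fixes x y :: real
  shows "ennreal ((x - y)\<^sup>2) = 2 * (\<integral>\<^sup>+s. \<integral>\<^sup>+t.
     ((if x \<le> s \<and> s \<le> t \<and> t < y then 1 else 0)
      + (if y \<le> s \<and> s \<le> t \<and> t < x then 1 else 0)) \<partial>lborel \<partial>lborel)"
proof -
  have m: "(\<lambda>(s, t). (if a \<le> s \<and> s \<le> t \<and> t < b then 1 else 0 :: ennreal))
      \<in> borel_measurable (lborel \<Otimes>\<^sub>M lborel)" for a b :: real
    by measurable
  have m1: "(\<lambda>t. (if a \<le> s \<and> s \<le> t \<and> t < b then 1 else 0 :: ennreal))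
      \<in> borel_measurable lborel" for s a b :: real
    by measurable
  have m2: "(\<lambda>s. \<integral>\<^sup>+t. (if a \<le> s \<and> s \<le> t \<and> t < b then 1 else 0 :: ennreal) \<partial>lborel)
      \<in> borel_measurable lborel" for a b :: real
    using sigma_finite_measure.borel_measurable_nn_integral[OF _ m[of a b]]
    by (simp add: lborel.sigma_finite_measure_axioms)
  have "(x - y)\<^sup>2 = 2 * ((if x < y then (y - x)\<^sup>2 / 2 else 0) + (if y < x then (x - y)\<^sup>2 / 2 else 0))"
    by (auto simp: power2_commute)
  moreover have "(\<integral>\<^sup>+s. \<integral>\<^sup>+t.
     ((if x \<le> s \<and> s \<le> t \<and> t < y then 1 else 0)
      + (if y \<le> s \<and> s \<le> t \<and> t < x then 1 else 0)) \<partial>lborel \<partial>lborel)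
    = ennreal (if x < y then (y - x)\<^sup>2 / 2 else 0) + ennreal (if y < x then (x - y)\<^sup>2 / 2 else 0)"
    by (subst nn_integral_add, (rule m1)+, subst nn_integral_add, (rule m2)+)
      (simp only: nn_integral_triangle)
  moreover have "2 * ennreal a = ennreal (2 * a)" for a
    by (metis ennreal_mult' ennreal_numeral zero_le_numeral)
  ultimately show ?thesis
    by (simp only: distrib_left ennreal_plus[symmetric]) (auto simp: power2_commute)
qed

text \<open>By Fubini, the joint law enters the mean square only through the probabilities of
  \<open>X \<le> s\<close>, \<open>t < Y\<close> and of the same event with the roles exchanged. All
  terms of this form of Hoeffding's formula are nonnegative, so it covers the value \<infinity> as
  well.\<close>

lemma expectation_square_diff:
  fixes X Y :: "'b \<Rightarrow> real"
  assumes "prob_space P" and [measurable]: "X \<in> borel_measurable P" "Y \<in> borel_measurable P"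
  shows "(\<integral>\<^sup>+\<omega>. ennreal ((X \<omega> - Y \<omega>)\<^sup>2) \<partial>P) = 2 * (\<integral>\<^sup>+s. \<integral>\<^sup>+t.
     (if s \<le> t then emeasure P {\<omega>\<in>space P. X \<omega> \<le> s \<and> t < Y \<omega>} +
        emeasure P {\<omega>\<in>space P. Y \<omega> \<le> s \<and> t < X \<omega>} else 0) \<partial>lborel \<partial>lborel)"
proof -
  interpret prob_space P by fact
  interpret pair_sigma_finite P "lborel :: real measure" ..
  let ?k = "\<lambda>\<omega> s t. (if X \<omega> \<le> s \<and> s \<le> t \<and> t < Y \<omega> then 1 else 0)
      + (if Y \<omega> \<le> s \<and> s \<le> t \<and> t < X \<omega> then 1 else 0) :: ennreal"
  have k: "?k \<omega> s t = (if s \<le> t then indicator {\<omega>\<in>space P. X \<omega> \<le> s \<and> t < Y \<omega>} \<omega>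
        + indicator {\<omega>\<in>space P. Y \<omega> \<le> s \<and> t < X \<omega>} \<omega> else 0)" if "\<omega> \<in> space P" for \<omega> s t
    using that by (auto split: split_indicator)
  have km [measurable]: "(\<lambda>(\<omega>, s, t). ?k \<omega> s t) \<in> borel_measurable (P \<Otimes>\<^sub>M lborel \<Otimes>\<^sub>M lborel)"
    by measurable
  have "(\<integral>\<^sup>+\<omega>. ennreal ((X \<omega> - Y \<omega>)\<^sup>2) \<partial>P) = (\<integral>\<^sup>+\<omega>. 2 * (\<integral>\<^sup>+s. \<integral>\<^sup>+t. ?k \<omega> s t \<partial>lborel \<partial>lborel) \<partial>P)"
    by (intro nn_integral_cong square_diff_eq_nn_integral)
  also have "\<dots> = 2 * (\<integral>\<^sup>+\<omega>. \<integral>\<^sup>+s. \<integral>\<^sup>+t. ?k \<omega> s t \<partial>lborel \<partial>lborel \<partial>P)"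
    by (intro nn_integral_cmult) measurable
  also have "(\<integral>\<^sup>+\<omega>. \<integral>\<^sup>+s. \<integral>\<^sup>+t. ?k \<omega> s t \<partial>lborel \<partial>lborel \<partial>P)
      = (\<integral>\<^sup>+s. \<integral>\<^sup>+\<omega>. \<integral>\<^sup>+t. ?k \<omega> s t \<partial>lborel \<partial>P \<partial>lborel)"
    by (rule Fubini'[symmetric]) measurable
  also have "\<dots> = (\<integral>\<^sup>+s. \<integral>\<^sup>+t. \<integral>\<^sup>+\<omega>. ?k \<omega> s t \<partial>P \<partial>lborel \<partial>lborel)"
  proof (intro nn_integral_cong Fubini'[symmetric])
    fix s :: real
    show "(\<lambda>(\<omega>, t). ?k \<omega> s t) \<in> borel_measurable (P \<Otimes>\<^sub>M lborel)"
      by measurable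
  qed
  also have "\<dots> = (\<integral>\<^sup>+s. \<integral>\<^sup>+t. (if s \<le> t then emeasure P {\<omega>\<in>space P. X \<omega> \<le> s \<and> t < Y \<omega>} +
        emeasure P {\<omega>\<in>space P. Y \<omega> \<le> s \<and> t < X \<omega>} else 0) \<partial>lborel \<partial>lborel)"
  proof (intro nn_integral_cong)
    fix s t :: real
    have "(\<integral>\<^sup>+\<omega>. ?k \<omega> s t \<partial>P) = (\<integral>\<^sup>+\<omega>. (if s \<le> t then indicator {\<omega>\<in>space P. X \<omega> \<le> s \<and> t < Y \<omega>} \<omega>
        + indicator {\<omega>\<in>space P. Y \<omega> \<le> s \<and> t < X \<omega>} \<omega> else 0) \<partial>P)"
      by (rule nn_integral_cong) (rule k)
    also have "\<dots> = (if s \<le> t then emeasure P {\<omega>\<in>space P. X \<omega> \<le> s \<and> t < Y \<omega>} +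
        emeasure P {\<omega>\<in>space P. Y \<omega> \<le> s \<and> t < X \<omega>} else 0)"
      by (cases "s \<le> t") (simp_all add: nn_integral_add)
    finally show "(\<integral>\<^sup>+\<omega>. ?k \<omega> s t \<partial>P) = \<dots>" .
  qed
  finally show ?thesis .
qed

text \<open>By Hoeffding's formula this is the cost of the monotone coupling, and no coupling does
  better; \<open>ennreal\<close> truncates the negative differences to \<open>0\<close>.\<close>

definition cdf_cost :: "real measure \<Rightarrow> real measure \<Rightarrow> ennreal" where
  "cdf_cost M N = 2 * (\<integral>\<^sup>+s. \<integral>\<^sup>+t. (if s \<le> t then ennreal (cdf M s - cdf N t) +
        ennreal (cdf N s - cdf M t) else 0) \<partial>lborel \<partial>lborel)"

text \<open>A Frechet bound: the joint probability of \<open>A \<le> s\<close> and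
  \<open>t < B\<close> is at least the probability of \<open>A \<le> s\<close> minus that of
  \<open>B \<le> t\<close>, and this difference depends on the marginals alone.\<close>

lemma cdf_cost_le_expectation:
  fixes X Y :: "'b \<Rightarrow> real"
  assumes "prob_space P" and [measurable]: "X \<in> borel_measurable P" "Y \<in> borel_measurable P"
  shows "cdf_cost (distr P borel X) (distr P borel Y) \<le> (\<integral>\<^sup>+\<omega>. ennreal ((X \<omega> - Y \<omega>)\<^sup>2) \<partial>P)"
proof -
  interpret prob_space P by fact
  have le: "ennreal (cdf (distr P borel A) s - cdf (distr P borel B) t)
      \<le> emeasure P {\<omega>\<in>space P. A \<omega> \<le> s \<and> t < B \<omega>}"
    if [measurable]: "A \<in> borel_measurable P" "B \<in> borel_measurable P" for A B :: "'b \<Rightarrow> real" and s t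
  proof -
    have "cdf (distr P borel A) s = prob {\<omega>\<in>space P. A \<omega> \<le> s}"
      by (auto simp: cdf_def measure_distr intro!: arg_cong[where f = prob])
    also have "\<dots> \<le> prob ({\<omega>\<in>space P. A \<omega> \<le> s \<and> t < B \<omega>} \<union> {\<omega>\<in>space P. B \<omega> \<le> t})"
      by (rule finite_measure_mono) auto
    also have "\<dots> \<le> prob {\<omega>\<in>space P. A \<omega> \<le> s \<and> t < B \<omega>} + prob {\<omega>\<in>space P. B \<omega> \<le> t}"
      by (rule measure_subadditive) auto
    also have "prob {\<omega>\<in>space P. B \<omega> \<le> t} = cdf (distr P borel B) t"
      by (auto simp: cdf_def measure_distr intro!: arg_cong[where f = prob])
    finally show ?thesis
      by (simp add: emeasure_eq_measure ennreal_leI)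
  qed
  show ?thesis
    unfolding cdf_cost_def expectation_square_diff[OF assms]
    by (intro mult_left_mono nn_integral_mono) (auto intro!: add_mono le)
qed

text \<open>For quantile functions the event is an interval of levels,
  \<open>cdf B t < u \<le> cdf A s\<close>, whose length attains the Frechet bound for all
  \<open>s\<close> and \<open>t\<close> at once.\<close>

lemma cdf_cost_eq_quantile:
  assumes M: "real_distribution M" and N: "real_distribution N"
  shows "cdf_cost M N = (\<integral>\<^sup>+u. ennreal ((quantile M u - quantile N u)\<^sup>2) \<partial>unit_lebesgue)"
proof -
  have eq: "emeasure unit_lebesgue {u\<in>space unit_lebesgue. quantile A u \<le> s \<and> t < quantile B u}
      = ennreal (cdf A s - cdf B t)" if A: "real_distribution A" and B: "real_distribution B" for A B s t
  proof -
    interpret A: real_distribution A by fact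
    interpret B: real_distribution B by fact
    have sub: "{u \<in> {0<..<1}. u \<le> cdf A s \<and> cdf B t < u} \<subseteq> {0<..<1}"
      by blast
    have "{u\<in>space unit_lebesgue. quantile A u \<le> s \<and> t < quantile B u}
        = {u \<in> {0<..<1}. u \<le> cdf A s \<and> cdf B t < u}"
      using quantile_le_iff[OF A] quantile_le_iff[OF B, of _ t]
      by (auto simp: space_restrict_space not_le[symmetric])
    then have "emeasure unit_lebesgue {u\<in>space unit_lebesgue. quantile A u \<le> s \<and> t < quantile B u}
        = emeasure lborel {u \<in> {0<..<1}. u \<le> cdf A s \<and> cdf B t < u}"
      using emeasure_restrict_space[OF _ sub, of lborel] by (simp only:) simp
    also have "\<dots> = emeasure lborel {cdf B t<..cdf A s}"
    proof (rule emeasure_eq_AE)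
      \<comment> \<open>The half-open interval may contain the level 1, which the open unit interval
        omits; the two sets differ at most by this point.\<close>
      have "AE u in lborel. u \<noteq> (1::real)" by (rule AE_lborel_singleton)
      then show "AE u in lborel. u \<in> {u \<in> {0<..<1}. u \<le> cdf A s \<and> cdf B t < u}
          \<longleftrightarrow> u \<in> {cdf B t<..cdf A s}"
      proof eventually_elim
        case (elim u)
        then show ?case
          using A.cdf_bounded_prob[of s] B.cdf_nonneg[of t] by auto
      qed
    qed auto
    also have "\<dots> = ennreal (cdf A s - cdf B t)"
      by (cases "cdf B t \<le> cdf A s") (auto simp: ennreal_neg)
    finally show ?thesis .
  qed
  show ?thesis
    unfolding cdf_cost_def
    by (subst expectation_square_diff[OF prob_space_unit_lebesgue measurable_quantile[OF M]
        measurable_quantile[OF N]]) (simp only: eq[OF M N] eq[OF N M])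
qed

lemma measurable_coupling:
  assumes "\<gamma> \<in> couplings M N"
  shows "fst \<in> borel_measurable \<gamma>" "snd \<in> borel_measurable \<gamma>"
proof -
  have "sets \<gamma> = sets (borel \<Otimes>\<^sub>M borel)"
    using assms by (simp add: couplings_def)
  then have *: "borel_measurable \<gamma> = borel_measurable (borel \<Otimes>\<^sub>M borel)"
    by (rule measurable_cong_sets) simp
  show "fst \<in> borel_measurable \<gamma>" "snd \<in> borel_measurable \<gamma>"
    unfolding * by measurable
qed

text \<open>The infimum is attained by the image of Lebesgue measure under the pair of quantile
  functions. Its equality with \<open>cdf_cost\<close> includes the value \<infinity>, which
  \<open>enn2real\<close> sends to 0 on both sides.\<close>

lemma wasserstein2_real:
  assumes M: "real_distribution M" and N: "real_distribution N"
  shows "(wasserstein2 M N)\<^sup>2 = enn2real (cdf_cost M N)"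
proof -
  let ?Q = "distr unit_lebesgue (borel \<Otimes>\<^sub>M borel) (\<lambda>u. (quantile M u, quantile N u))"
  interpret U: prob_space unit_lebesgue by (rule prob_space_unit_lebesgue)
  note [measurable] = measurable_quantile[OF M] measurable_quantile[OF N]
  have Qm: "(\<lambda>u. (quantile M u, quantile N u)) \<in> unit_lebesgue \<rightarrow>\<^sub>M borel \<Otimes>\<^sub>M borel"
    by measurable
  have "distr ?Q borel fst = M" "distr ?Q borel snd = N"
    by (simp_all add: distr_distr[OF _ Qm] comp_def distr_quantile M N)
  then have Q: "?Q \<in> couplings M N"
    using U.prob_space_distr[OF Qm] by (auto simp: couplings_def)
  have "(INF \<gamma> \<in> couplings M N. \<integral>\<^sup>+ (x, y). ennreal ((dist x y)\<^sup>2) \<partial>\<gamma>) = cdf_cost M N"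
  proof (rule antisym)
    have "(\<integral>\<^sup>+ (x, y). ennreal ((dist x y)\<^sup>2) \<partial>?Q)
        = (\<integral>\<^sup>+u. ennreal ((quantile M u - quantile N u)\<^sup>2) \<partial>unit_lebesgue)"
      by (subst nn_integral_distr[OF Qm]) (simp_all add: dist_real_def)
    also have "\<dots> = cdf_cost M N"
      by (rule cdf_cost_eq_quantile[OF M N, symmetric])
    finally have "(\<integral>\<^sup>+ (x, y). ennreal ((dist x y)\<^sup>2) \<partial>?Q) = cdf_cost M N" .
    then show "(INF \<gamma> \<in> couplings M N. \<integral>\<^sup>+ (x, y). ennreal ((dist x y)\<^sup>2) \<partial>\<gamma>) \<le> cdf_cost M N"
      by (intro INF_lower2[OF Q]) simp
    show "cdf_cost M N \<le> (INF \<gamma> \<in> couplings M N. \<integral>\<^sup>+ (x, y). ennreal ((dist x y)\<^sup>2) \<partial>\<gamma>)"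
    proof (rule INF_greatest)
      fix \<gamma> assume g: "\<gamma> \<in> couplings M N"
      then show "cdf_cost M N \<le> (\<integral>\<^sup>+ (x, y). ennreal ((dist x y)\<^sup>2) \<partial>\<gamma>)"
        using cdf_cost_le_expectation[of \<gamma> fst snd] measurable_coupling[OF g]
        by (auto simp: couplings_def dist_real_def split_beta')
    qed
  qed
  then show ?thesis
    by (simp add: wasserstein2_def)
qed

subsection \<open>Measures are determined by integrals of cosines\<close>

text \<open>The phase \<open>a\<close> brings in the sines, so that the product-to-sum formula keeps
  the class closed under multiplication.\<close>

inductive trigonometric :: "('a::real_inner \<Rightarrow> real) \<Rightarrow> bool" where
  cos: "trigonometric (\<lambda>x. c * cos (\<xi> \<bullet> x + a))"
| add: "trigonometric f \<Longrightarrow> trigonometric g \<Longrightarrow> trigonometric (\<lambda>x. f x + g x)"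

lemma trigonometric_const: "trigonometric (\<lambda>x. c)"
  using trigonometric.cos[of c 0 0] by simp

lemma trigonometric_sum:
  assumes "\<And>i. i \<in> I \<Longrightarrow> trigonometric (f i)"
  shows "trigonometric (\<lambda>x. \<Sum>i\<in>I. f i x)"
  using assms by (induction I rule: infinite_finite_induct)
    (auto intro: trigonometric_const trigonometric.add)

lemma trigonometric_mult:
  assumes "trigonometric f" "trigonometric g"
  shows "trigonometric (\<lambda>x. f x * g x)"
  using assms(1)
proof (induction rule: trigonometric.induct)
  case (cos c \<xi> a)
  show ?case using assms(2)
  proof (induction rule: trigonometric.induct)
    case (cos d \<eta> b)
    have "c * cos (\<xi> \<bullet> x + a) * (d * cos (\<eta> \<bullet> x + b))
      = c * d / 2 * cos ((\<xi> - \<eta>) \<bullet> x + (a - b)) + c * d / 2 * cos ((\<xi> + \<eta>) \<bullet> x + (a + b))" for x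
    proof -
      have *: "(\<xi> - \<eta>) \<bullet> x + (a - b) = (\<xi> \<bullet> x + a) - (\<eta> \<bullet> x + b)"
        "(\<xi> + \<eta>) \<bullet> x + (a + b) = (\<xi> \<bullet> x + a) + (\<eta> \<bullet> x + b)"
        by (simp_all add: algebra_simps)
      show ?thesis unfolding * cos_diff cos_add by (simp add: algebra_simps)
    qed
    then show ?case
      by (simp only: trigonometric.intros)
  next
    case (add g h)
    then show ?case using trigonometric.add by (simp add: distrib_left)
  qed
next
  case (add f h)
  then show ?case using trigonometric.add by (simp add: distrib_right)
qed

lemma trigonometric_bounded_continuous:
  "trigonometric f \<Longrightarrow> continuous_on UNIV f \<and> (\<exists>B. \<forall>x. \<bar>f x\<bar> \<le> B)"
proof (induction rule: trigonometric.induct)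
  case (cos c \<xi> a)
  have "\<bar>c * cos (\<xi> \<bullet> x + a)\<bar> \<le> \<bar>c\<bar>" for x
    by (simp add: abs_mult mult_left_le)
  then show ?case by (auto intro!: continuous_intros)
next
  case (add f g)
  then obtain A B where "\<And>x. \<bar>f x\<bar> \<le> A" "\<And>x. \<bar>g x\<bar> \<le> B" by auto
  then have "\<bar>f x + g x\<bar> \<le> A + B" for x
    by (meson abs_triangle_ineq add_mono order_trans)
  with add show ?case by (auto intro!: continuous_intros)
qed

text \<open>Polynomials are generated by bounded linear functionals and constants under sums and
  products, so along \<open>E\<close> only the linear ones have to be checked.\<close>

lemma trigonometric_real_polynomial_function:
  assumes "real_polynomial_function p"
    and E: "\<And>h. bounded_linear h \<Longrightarrow> trigonometric (\<lambda>x. h (E x))"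
  shows "trigonometric (\<lambda>x. p (E x))"
  using assms(1)
  by (induction rule: real_polynomial_function.induct)
    (auto intro: E trigonometric_const trigonometric.add trigonometric_mult)

text \<open>Squaring gives \<open>2 * k\<^sup>2 = m\<^sup>2\<close>, where for nonzero
  \<open>k\<close> the exponent of 2 is odd on the left and even on the right.\<close>

lemma int_sqrt2_mult_eq_0:
  fixes k m :: int
  assumes "sqrt 2 * of_int k = of_int m"
  shows "k = 0"
proof (rule ccontr)
  assume k: "k \<noteq> 0"
  have "(2::real) * (of_int k)\<^sup>2 = (of_int m)\<^sup>2"
    using arg_cong[OF assms, of "\<lambda>x. x\<^sup>2"] by (simp add: power_mult_distrib)
  then have "of_int (2 * k\<^sup>2) = (of_int (m\<^sup>2) :: real)"
    by simp
  then have eq: "2 * k\<^sup>2 = m\<^sup>2"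
    by (simp only: of_int_eq_iff)
  with k have m: "m \<noteq> 0" by auto
  have "multiplicity 2 (2 * k\<^sup>2) = 1 + 2 * multiplicity 2 k"
    using k by (subst prime_elem_multiplicity_mult_distrib)
      (auto simp: prime_elem_multiplicity_power_distrib)
  moreover have "multiplicity 2 (m\<^sup>2) = 2 * multiplicity 2 m"
    using m by (auto simp: prime_elem_multiplicity_power_distrib)
  ultimately show False
    using eq by (metis even_plus_one_iff even_mult_iff dvd_refl odd_one add.commute dvd_triv_left)
qed

text \<open>A winding of the torus whose two frequencies are incommensurable in each coordinate, which
  makes it injective.\<close>

definition winding :: "'a::euclidean_space \<Rightarrow> ('a \<times> 'a) \<times> 'a \<times> 'a" where
  "winding x =
    ((\<Sum>b\<in>Basis. cos (x \<bullet> b) *\<^sub>R b, \<Sum>b\<in>Basis. sin (x \<bullet> b) *\<^sub>R b),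
     (\<Sum>b\<in>Basis. cos (sqrt 2 * (x \<bullet> b)) *\<^sub>R b, \<Sum>b\<in>Basis. sin (sqrt 2 * (x \<bullet> b)) *\<^sub>R b))"

text \<open>In each coordinate the difference and its multiple by \<open>sqrt 2\<close> are both
  integer multiples of \<open>2 * pi\<close>, which the irrationality of \<open>sqrt 2\<close>
  allows only for the difference 0.\<close>

lemma inj_winding: "inj winding"
proof (rule injI)
  fix x y :: 'a
  assume "winding x = winding y"
  then have "(\<Sum>b\<in>Basis. cos (x \<bullet> b) *\<^sub>R b) = (\<Sum>b\<in>Basis. cos (y \<bullet> b) *\<^sub>R b)"
    "(\<Sum>b\<in>Basis. sin (x \<bullet> b) *\<^sub>R b) = (\<Sum>b\<in>Basis. sin (y \<bullet> b) *\<^sub>R b)"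
    "(\<Sum>b\<in>Basis. cos (sqrt 2 * (x \<bullet> b)) *\<^sub>R b) = (\<Sum>b\<in>Basis. cos (sqrt 2 * (y \<bullet> b)) *\<^sub>R b)"
    "(\<Sum>b\<in>Basis. sin (sqrt 2 * (x \<bullet> b)) *\<^sub>R b) = (\<Sum>b\<in>Basis. sin (sqrt 2 * (y \<bullet> b)) *\<^sub>R b)"
    unfolding winding_def by simp_all
  note * = this
  have co: "f b = g b" if "(\<Sum>b\<in>Basis. f b *\<^sub>R b) = (\<Sum>b\<in>Basis. g b *\<^sub>R b)" "b \<in> Basis"
    for f g and b :: 'a
    using arg_cong[OF that(1), of "\<lambda>v. v \<bullet> b"] that(2) by simp
  note cs = co[OF *(1)] co[OF *(2)] co[OF *(3)] co[OF *(4)]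
  have "x \<bullet> b = y \<bullet> b" if b: "b \<in> Basis" for b
  proof -
    obtain k :: int where k: "x \<bullet> b = y \<bullet> b + 2 * pi * of_int k"
      using cs(1,2)[OF b] sin_cos_eq_iff[of "x \<bullet> b" "y \<bullet> b"] by auto
    obtain m :: int where m: "sqrt 2 * (x \<bullet> b) = sqrt 2 * (y \<bullet> b) + 2 * pi * of_int m"
      using cs(3,4)[OF b] sin_cos_eq_iff[of "sqrt 2 * (x \<bullet> b)" "sqrt 2 * (y \<bullet> b)"] by auto
    have "2 * pi * (sqrt 2 * of_int k) = 2 * pi * of_int m"
      using m unfolding k by (simp add: algebra_simps)
    then have "sqrt 2 * of_int k = of_int m"
      by (subst (asm) mult_cancel_left) auto
    then have "k = 0" by (rule int_sqrt2_mult_eq_0)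
    with k show ?thesis by simp
  qed
  then show "x = y" by (rule euclidean_eqI)
qed

lemma trigonometric_winding:
  fixes h :: "('a::euclidean_space \<times> 'a) \<times> 'a \<times> 'a \<Rightarrow> real"
  assumes "bounded_linear h"
  shows "trigonometric (\<lambda>x. h (winding x))"
proof -
  interpret bounded_linear h by fact
  have "h (winding x) = h ((\<Sum>b\<in>Basis. cos (x \<bullet> b) *\<^sub>R b, 0), 0) + h ((0, \<Sum>b\<in>Basis. sin (x \<bullet> b) *\<^sub>R b), 0)
     + h (0, (\<Sum>b\<in>Basis. cos (sqrt 2 * (x \<bullet> b)) *\<^sub>R b, 0))
     + h (0, (0, \<Sum>b\<in>Basis. sin (sqrt 2 * (x \<bullet> b)) *\<^sub>R b))" for x
    by (simp add: winding_def add[symmetric] zero_prod_def)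
  moreover have "h ((\<Sum>b\<in>Basis. f b *\<^sub>R b, 0), 0) = (\<Sum>b\<in>Basis. f b * h ((b, 0), 0))" for f
  proof -
    interpret l: bounded_linear "\<lambda>v. h ((v, 0), 0)"
      by (rule bounded_linear_compose[OF assms]) (intro bounded_linear_intros)
    show ?thesis by (simp add: l.sum l.scaleR)
  qed
  moreover have "h ((0, \<Sum>b\<in>Basis. f b *\<^sub>R b), 0) = (\<Sum>b\<in>Basis. f b * h ((0, b), 0))" for f
  proof -
    interpret l: bounded_linear "\<lambda>v. h ((0, v), 0)"
      by (rule bounded_linear_compose[OF assms]) (intro bounded_linear_intros)
    show ?thesis by (simp add: l.sum l.scaleR)
  qed
  moreover have "h (0, (\<Sum>b\<in>Basis. f b *\<^sub>R b, 0)) = (\<Sum>b\<in>Basis. f b * h (0, (b, 0)))" for f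
  proof -
    interpret l: bounded_linear "\<lambda>v. h (0, (v, 0))"
      by (rule bounded_linear_compose[OF assms]) (intro bounded_linear_intros)
    show ?thesis by (simp add: l.sum l.scaleR)
  qed
  moreover have "h (0, (0, \<Sum>b\<in>Basis. f b *\<^sub>R b)) = (\<Sum>b\<in>Basis. f b * h (0, (0, b)))" for f
  proof -
    interpret l: bounded_linear "\<lambda>v. h (0, (0, v))"
      by (rule bounded_linear_compose[OF assms]) (intro bounded_linear_intros)
    show ?thesis by (simp add: l.sum l.scaleR)
  qed
  moreover have "trigonometric (\<lambda>x::'a. cos (r * (x \<bullet> b)) * c)"
    "trigonometric (\<lambda>x::'a. sin (r * (x \<bullet> b)) * c)" for r c b
    \<comment> \<open>A sine is a cosine with phase \<open>- pi / 2\<close>.\<close>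
    using trigonometric.cos[of c "r *\<^sub>R b" 0] trigonometric.cos[of c "r *\<^sub>R b" "- pi / 2"]
    by (simp_all add: inner_commute mult.commute cos_diff)
  from this[of 1] this[of "sqrt 2"] have
    "trigonometric (\<lambda>x::'a. cos (x \<bullet> b) * c)" "trigonometric (\<lambda>x::'a. sin (x \<bullet> b) * c)"
    "trigonometric (\<lambda>x::'a. cos (sqrt 2 * (x \<bullet> b)) * c)"
    "trigonometric (\<lambda>x::'a. sin (sqrt 2 * (x \<bullet> b)) * c)" for b c
    by simp_all
  ultimately show ?thesis
    by (simp only:) (intro trigonometric.add trigonometric_sum)
qed

lemma continuous_on_winding: "continuous_on UNIV winding"
  unfolding winding_def by (intro continuous_intros)

lemma bounded_range_winding: "bounded (range (winding :: 'a::euclidean_space \<Rightarrow> _))"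
proof -
  have "norm (\<Sum>b\<in>Basis. f b *\<^sub>R b :: 'a) \<le> DIM('a)" if "\<And>b. \<bar>f b\<bar> \<le> 1" for f
    using sum_norm_le[of Basis "\<lambda>b. f b *\<^sub>R b :: 'a" "\<lambda>_. 1"] that by simp
  note * = this
  have "norm (winding x) \<le> (real DIM('a) + real DIM('a)) + (real DIM('a) + real DIM('a))" for x :: 'a
    unfolding winding_def
    by (intro order_trans[OF norm_Pair_le] order_trans[OF add_mono[OF norm_Pair_le norm_Pair_le]] add_mono)
      (rule *, simp)+
  then show ?thesis by (auto simp: bounded_iff)
qed

text \<open>Compact sets are stable under intersection and generate the Borel sets, every closed set
  being a countable union of them. Closed sets would not do later, since their images under the
  winding need not be closed.\<close>

lemma finite_measure_eq_if_compact_eq: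
  fixes \<mu> \<nu> :: "'a::euclidean_space measure"
  assumes "finite_measure \<mu>" and s: "sets \<mu> = sets borel" "sets \<nu> = sets borel"
    and K: "\<And>K. compact K \<Longrightarrow> emeasure \<mu> K = emeasure \<nu> K"
  shows "\<mu> = \<nu>"
proof (rule measure_eqI_generator_eq[where \<Omega> = UNIV and E = "Collect compact" and A = "\<lambda>n. cball 0 (real n)"])
  interpret finite_measure \<mu> by fact
  show "Int_stable (Collect (compact :: 'a set \<Rightarrow> bool))"
    by (auto simp: Int_stable_def intro: compact_Int)
  have "sets (borel :: 'a measure) = sigma_sets UNIV (Collect compact)"
  proof
    have "closed S \<Longrightarrow> S \<in> sigma_sets UNIV (Collect compact)" for S :: "'a set"
    proof -
      assume S: "closed S"
      have "(\<Union>n. S \<inter> cball 0 (real n)) = S"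
        by (auto simp: real_arch_simple)
      moreover have "(\<Union>n. S \<inter> cball 0 (real n)) \<in> sigma_sets UNIV (Collect compact)"
        using S by (intro sigma_sets.Union) (auto intro!: sigma_sets.Basic closed_Int_compact)
      ultimately show ?thesis by simp
    qed
    then have "sigma_sets UNIV (Collect closed) \<subseteq> sigma_sets UNIV (Collect (compact :: 'a set \<Rightarrow> bool))"
      by (intro sigma_sets_mono) auto
    then show "sets (borel :: 'a measure) \<subseteq> sigma_sets UNIV (Collect compact)"
      by (simp add: borel_eq_closed sets_measure_of)
    show "sigma_sets UNIV (Collect compact) \<subseteq> sets (borel :: 'a measure)"
      using sets.sigma_sets_subset[of "Collect compact" "borel :: 'a measure"]
      by (simp add: borel_compact subset_eq)
  qed
  then show "sets \<mu> = sigma_sets UNIV (Collect compact)" "sets \<nu> = sigma_sets UNIV (Collect compact)"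
    using s by simp_all
  show "(\<Union>n. cball 0 (real n)) = (UNIV :: 'a set)"
    by (auto simp: real_arch_simple)
  show "emeasure \<mu> (cball 0 (real n)) \<noteq> \<infinity>" for n
    by simp
qed (use K in auto)

text \<open>Since the winding is injective, the indicator of a compact set is a limit of continuous
  functions of the winding, hence, by Stone-Weierstrass, of trigonometric functions.\<close>

lemma measure_eqI_cos:
  fixes \<mu> \<nu> :: "'a::euclidean_space measure"
  assumes "prob_space \<mu>" "prob_space \<nu>" and s [measurable_cong]: "sets \<mu> = sets borel" "sets \<nu> = sets borel"
    and eq: "\<And>\<xi> a. (\<integral>x. cos (\<xi> \<bullet> x + a) \<partial>\<mu>) = (\<integral>x. cos (\<xi> \<bullet> x + a) \<partial>\<nu>)"
  shows "\<mu> = \<nu>"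
proof (rule finite_measure_eq_if_compact_eq)
  interpret m: prob_space \<mu> by fact
  interpret n: prob_space \<nu> by fact
  show "finite_measure \<mu>" by (rule m.finite_measure_axioms)
  have int: "integrable \<mu> f" "integrable \<nu> f" if f: "continuous_on UNIV f" "\<And>x. \<bar>f x\<bar> \<le> B" for f :: "'a \<Rightarrow> real" and B
  proof -
    have [measurable]: "f \<in> borel_measurable borel"
      by (rule borel_measurable_continuous_onI) fact
    show "integrable \<mu> f" by (rule m.integrable_const_bound[of _ B]) (use f in auto)
    show "integrable \<nu> f" by (rule n.integrable_const_bound[of _ B]) (use f in auto)
  qed
  have trig: "(\<integral>x. f x \<partial>\<mu>) = (\<integral>x. f x \<partial>\<nu>)" if "trigonometric f" for f
    using that
  proof (induction rule: trigonometric.induct)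
    case (cos c \<xi> a)
    then show ?case by (simp add: eq)
  next
    case (add f g)
    obtain A B where "\<And>x. \<bar>f x\<bar> \<le> A" "\<And>x. \<bar>g x\<bar> \<le> B"
      using add.hyps trigonometric_bounded_continuous by metis
    moreover have "continuous_on UNIV f" "continuous_on UNIV g"
      using add.hyps trigonometric_bounded_continuous by auto
    ultimately show ?case
      using add.IH int[of f A] int[of g B] by simp
  qed
  obtain R where R: "range winding \<subseteq> cball (0 :: ('a \<times> 'a) \<times> 'a \<times> 'a) R"
    using bounded_range_winding[where 'a = 'a] unfolding bounded_iff subset_iff mem_cball_0 by blast
  have winding: "(\<integral>x. f (winding x) \<partial>\<mu>) = (\<integral>x. f (winding x) \<partial>\<nu>)"
    if f: "continuous_on UNIV f" "\<And>z. \<bar>f z\<bar> \<le> 1" for f :: "('a \<times> 'a) \<times> 'a \<times> 'a \<Rightarrow> real"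
  proof -
    have fw: "continuous_on UNIV (\<lambda>x. f (winding x))"
      by (rule continuous_on_compose2[OF f(1) continuous_on_winding]) auto
    \<comment> \<open>Uniform approximation on a ball containing the range of the winding costs
      \<open>e / 2\<close> for each measure, and both measures integrate the trigonometric
      approximant alike.\<close>
    have "\<bar>(\<integral>x. f (winding x) \<partial>\<mu>) - (\<integral>x. f (winding x) \<partial>\<nu>)\<bar> \<le> e" if e: "e > 0" for e
    proof -
      obtain p where p: "real_polynomial_function p" "\<And>z. z \<in> cball 0 R \<Longrightarrow> \<bar>f z - p z\<bar> < e / 2"
        using Stone_Weierstrass_real_polynomial_function[OF compact_cball
            continuous_on_subset[OF f(1) subset_UNIV]] e half_gt_zero by metis
      have pt: "trigonometric (\<lambda>x. p (winding x))"
        by (rule trigonometric_real_polynomial_function[OF p(1)]) (rule trigonometric_winding)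
      then obtain B where B: "continuous_on UNIV (\<lambda>x::'a. p (winding x))" "\<And>x::'a. \<bar>p (winding x)\<bar> \<le> B"
        using trigonometric_bounded_continuous by blast
      have close: "\<bar>f (winding x) - p (winding x)\<bar> \<le> e / 2" for x :: 'a
        using p(2)[OF subsetD[OF R rangeI], of x] by simp
      have *: "\<bar>(\<integral>x. f (winding x) \<partial>\<rho>) - (\<integral>x. p (winding x) \<partial>\<rho>)\<bar> \<le> e / 2"
        if "prob_space \<rho>" "integrable \<rho> (\<lambda>x. f (winding x))" "integrable \<rho> (\<lambda>x. p (winding x))"
        for \<rho> :: "'a measure"
      proof -
        interpret prob_space \<rho> by fact
        have "\<bar>(\<integral>x. f (winding x) \<partial>\<rho>) - (\<integral>x. p (winding x) \<partial>\<rho>)\<bar>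
            = \<bar>\<integral>x. f (winding x) - p (winding x) \<partial>\<rho>\<bar>"
          using that by simp
        also have "\<dots> \<le> (\<integral>x. \<bar>f (winding x) - p (winding x)\<bar> \<partial>\<rho>)"
          by (rule integral_abs_bound)
        also have "\<dots> \<le> (\<integral>x. e / 2 \<partial>\<rho>)"
          using that by (intro integral_mono close) auto
        finally show ?thesis by (simp add: prob_space)
      qed
      have "\<bar>(\<integral>x. f (winding x) \<partial>\<mu>) - (\<integral>x. p (winding x) \<partial>\<mu>)\<bar> \<le> e / 2"
        by (rule *) (use int[OF fw f(2)] int[OF B] m.prob_space_axioms in auto)
      moreover have "\<bar>(\<integral>x. f (winding x) \<partial>\<nu>) - (\<integral>x. p (winding x) \<partial>\<nu>)\<bar> \<le> e / 2"
        by (rule *) (use int[OF fw f(2)] int[OF B] n.prob_space_axioms in auto)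
      ultimately show ?thesis
        using trig[OF pt] by (auto simp: abs_if split: if_splits)
    qed
    then show ?thesis
      using field_le_epsilon[of "\<bar>(\<integral>x. f (winding x) \<partial>\<mu>) - (\<integral>x. f (winding x) \<partial>\<nu>)\<bar>" 0] by auto
  qed
  fix K :: "'a set" assume K: "compact K"
  show "emeasure \<mu> K = emeasure \<nu> K"
  \<comment> \<open>\<open>infdist\<close> to the empty set is 0 by convention, so for empty
    \<open>K\<close> the functions below would be constantly 1.\<close>
  proof (cases "K = {}")
    case False
    let ?W = "winding ` K"
    define f where "f k z = max 0 (1 - real k * infdist z ?W)" for k z
    have f: "continuous_on UNIV (f k)" "\<bar>f k z\<bar> \<le> 1" for k z
      unfolding f_def by (auto intro!: continuous_intros simp: infdist_nonneg)
    have "compact ?W"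
      using K by (intro compact_continuous_image continuous_on_subset[OF continuous_on_winding]) auto
    then have cl: "closed ?W" by (rule compact_imp_closed)
    have lim: "(\<lambda>k. f k (winding x)) \<longlonglongrightarrow> indicator K x" for x
    proof (cases "x \<in> K")
      case True
      then have "f k (winding x) = 1" for k by (simp add: f_def)
      then show ?thesis using True by simp
    next
      case False
      then have "winding x \<notin> ?W" using inj_winding by (auto dest: injD)
      then have d: "infdist (winding x) ?W > 0"
        using cl \<open>K \<noteq> {}\<close> by (subst infdist_pos_not_in_closed) auto
      obtain N where N: "1 / infdist (winding x) ?W < real N" using reals_Archimedean2 by blast
      have "f k (winding x) = 0" if "k \<ge> N" for k
      proof -
        have "1 \<le> real N * infdist (winding x) ?W" using N d by (simp add: field_simps)
        also have "\<dots> \<le> real k * infdist (winding x) ?W" using that d by (intro mult_right_mono) auto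
        finally show ?thesis by (simp add: f_def)
      qed
      then have "eventually (\<lambda>k. f k (winding x) = 0) sequentially"
        by (auto simp: eventually_sequentially)
      then show ?thesis using False by (simp add: tendsto_eventually)
    qed
    have [measurable]: "(\<lambda>x. f k (winding x)) \<in> borel_measurable borel" for k
      by (intro borel_measurable_continuous_onI continuous_on_compose2[OF f(1) continuous_on_winding]) auto
    have [measurable]: "K \<in> sets borel" using K by (simp add: compact_imp_closed)
    have "(\<lambda>k. \<integral>x. f k (winding x) \<partial>\<mu>) \<longlonglongrightarrow> (\<integral>x. indicator K x \<partial>\<mu>)"
      by (rule integral_dominated_convergence[where w = "\<lambda>_. 1"]) (use lim f in auto)
    moreover have "(\<lambda>k. \<integral>x. f k (winding x) \<partial>\<nu>) \<longlonglongrightarrow> (\<integral>x. indicator K x \<partial>\<nu>)"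
      by (rule integral_dominated_convergence[where w = "\<lambda>_. 1"]) (use lim f in auto)
    ultimately have "measure \<mu> K = measure \<nu> K"
      using winding[OF f] LIMSEQ_unique s by (force simp: sets_eq_imp_space_eq[OF s(1)] sets_eq_imp_space_eq[OF s(2)])
    then show ?thesis by (simp add: m.emeasure_eq_measure n.emeasure_eq_measure)
  qed simp
qed (use s in auto)

subsection \<open>Almost surely convergent representations\<close>

definition cantor_sum :: "(nat \<Rightarrow> int) \<Rightarrow> real" where
  "cantor_sum a = (\<Sum>m. 2 * of_int (a m) / 3 ^ Suc m)"

lemma
  assumes "\<And>m. a m \<in> {0, 1}"
  shows summable_cantor_sum: "summable (\<lambda>m. 2 * of_int (a m) / 3 ^ Suc m :: real)"
    and cantor_sum_nonneg: "0 \<le> cantor_sum a"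
    and cantor_sum_le_1: "cantor_sum a \<le> 1"
proof -
  have g: "(\<lambda>m. (2 / 3) * (1 / 3) ^ m :: real) sums ((2 / 3) * (1 / (1 - 1 / 3)))"
    by (intro sums_mult geometric_sums) simp
  have a: "0 \<le> real_of_int (a m)" "real_of_int (a m) \<le> 1" for m
    using assms[of m] by auto
  have le: "2 * real_of_int (a m) / 3 ^ Suc m \<le> (2 / 3) * (1 / 3) ^ m" for m
    using a(2)[of m] by (simp add: field_simps)
  show sm: "summable (\<lambda>m. 2 * of_int (a m) / 3 ^ Suc m :: real)"
    by (rule summable_comparison_test'[OF sums_summable[OF g]]) (use le a in auto)
  show "0 \<le> cantor_sum a"
    unfolding cantor_sum_def by (rule suminf_nonneg[OF sm]) (use a in auto)
  have "cantor_sum a \<le> (2 / 3) * (1 / (1 - 1 / 3))"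
    unfolding cantor_sum_def sums_unique[OF g]
    by (rule suminf_le[OF le sm sums_summable[OF g]])
  then show "cantor_sum a \<le> 1" by simp
qed

lemma cantor_sum_step:
  assumes "\<And>m. a m \<in> {0, 1}"
  shows "3 * cantor_sum a = 2 * of_int (a 0) + cantor_sum (\<lambda>m. a (Suc m))"
proof -
  have "cantor_sum a = (\<Sum>m. 2 * of_int (a (Suc m)) / 3 ^ Suc (Suc m)) + 2 * of_int (a 0) / 3"
    unfolding cantor_sum_def
    using suminf_split_head[OF summable_cantor_sum[of a, OF assms]] by simp
  then have "3 * cantor_sum a = 3 * ((\<Sum>m. 2 * of_int (a (Suc m)) / 3 ^ Suc (Suc m)) + 2 * of_int (a 0) / 3)"
    by simp
  also have "3 * (\<Sum>m. 2 * of_int (a (Suc m)) / 3 ^ Suc (Suc m)) = cantor_sum (\<lambda>m. a (Suc m))"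
    unfolding cantor_sum_def
    using summable_cantor_sum[of "\<lambda>m. a (Suc m)", OF assms]
    by (subst suminf_mult[symmetric]) (auto dest: summable_divide[of _ 3])
  then have "3 * ((\<Sum>m. 2 * of_int (a (Suc m)) / 3 ^ Suc (Suc m)) + 2 * of_int (a 0) / 3)
      = 2 * of_int (a 0) + cantor_sum (\<lambda>m. a (Suc m))"
    by (simp add: distrib_left)
  finally show ?thesis .
qed

text \<open>Multiplying by \<open>3 ^ m\<close> shifts the digits by \<open>m\<close> places. The
  integer split off is even because every ternary digit is 0 or 2; it is invisible to a function of
  period 2.\<close>

lemma cantor_sum_shift:
  assumes "\<And>m. a m \<in> {0, 1}"
  shows "\<exists>N::int. 3 ^ m * cantor_sum a = 2 * of_int N + cantor_sum (\<lambda>n. a (n + m))"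
proof (induction m)
  case 0
  show ?case by (intro exI[of _ 0]) simp
next
  case (Suc m)
  then obtain N :: int where "3 ^ m * cantor_sum a = 2 * of_int N + cantor_sum (\<lambda>n. a (n + m))"
    by blast
  then have "3 ^ Suc m * cantor_sum a = 3 * (2 * of_int N + cantor_sum (\<lambda>n. a (n + m)))"
    by simp
  also have "\<dots> = 2 * of_int (3 * N + a m) + cantor_sum (\<lambda>n. a (n + Suc m))"
    using cantor_sum_step[of "\<lambda>n. a (n + m)"] assms by (simp add: distrib_left)
  finally show ?case by blast
qed

text \<open>A continuous function of period 2 that is 0 on [0, 1/3] and 1 on [2/3, 1], since the
  cosine is 1/2 at \<open>pi / 3\<close> and -1/2 at \<open>2 * pi / 3\<close>. It stands in for the
  piecewise linear function of Schoenberg's construction.\<close>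

definition tooth :: "real \<Rightarrow> real" where
  "tooth t = max 0 (min 1 (1 / 2 - cos (pi * t)))"

text \<open>The leading digit puts the shifted point into [0, 1/3] or [2/3, 1], where
  \<open>tooth\<close> is constant. The gap between them leaves room for continuity, which is why
  binary digits are stored in base 3.\<close>

lemma tooth_cantor_sum:
  assumes a: "\<And>m. a m \<in> {0, 1}"
  shows "tooth (3 ^ m * cantor_sum a) = of_int (a m)"
proof -
  let ?c = "cantor_sum (\<lambda>n. a (n + m))" and ?c' = "cantor_sum (\<lambda>n. a (n + Suc m))"
  obtain N :: int where N: "3 ^ m * cantor_sum a = 2 * of_int N + ?c"
    using cantor_sum_shift[of a m, OF a] by blast
  have "pi * (2 * of_int N + ?c) = 2 * pi * of_int N + pi * ?c"
    by (simp add: algebra_simps)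
  then have "cos (pi * (3 ^ m * cantor_sum a)) = cos (pi * ?c)"
    by (simp only: N cos_add cos_int_2pin sin_int_2pin)
  then have t: "tooth (3 ^ m * cantor_sum a) = tooth ?c"
    by (simp add: tooth_def)
  have c: "3 * ?c = 2 * of_int (a m) + ?c'" "0 \<le> ?c'" "?c' \<le> 1"
    using cantor_sum_step[of "\<lambda>n. a (n + m)"] cantor_sum_nonneg[of "\<lambda>n. a (n + Suc m)"]
      cantor_sum_le_1[of "\<lambda>n. a (n + Suc m)"] a by simp_all
  consider "a m = 0" | "a m = 1" using a[of m] by auto
  then show ?thesis
  proof cases
    case 1
    then have "0 \<le> ?c" "?c \<le> 1 / 3" using c by simp_all
    then have "cos (pi * (1 / 3)) \<le> cos (pi * ?c)"
      by (intro cos_monotone_0_pi_le mult_left_mono) (auto simp: mult_le_cancel_left1)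
    then show ?thesis using 1 unfolding t by (simp add: tooth_def cos_60)
  next
    case 2
    then have "2 / 3 \<le> ?c" "?c \<le> 1" using c by simp_all
    then have "cos (pi * ?c) \<le> cos (pi * (2 / 3))"
      by (intro cos_monotone_0_pi_le mult_left_mono) (auto simp: mult_le_cancel_left2)
    then show ?thesis using 2 unfolding t by (simp add: tooth_def cos_120')
  qed
qed

definition binary_digit :: "nat \<Rightarrow> real \<Rightarrow> int" where
  "binary_digit k y = \<lfloor>2 ^ Suc k * y\<rfloor> - 2 * \<lfloor>2 ^ k * y\<rfloor>"

lemma binary_digit: "binary_digit k y \<in> {0, 1}"
proof -
  let ?z = "2 ^ k * y"
  have "2 * \<lfloor>?z\<rfloor> \<le> \<lfloor>2 * ?z\<rfloor>" "\<lfloor>2 * ?z\<rfloor> < 2 * \<lfloor>?z\<rfloor> + 2"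
    by linarith+
  then show ?thesis by (auto simp: binary_digit_def mult.assoc)
qed

text \<open>The partial sums telescope to \<open>\<lfloor>2 ^ n * y\<rfloor> / 2 ^ n\<close>,
  starting from \<open>\<lfloor>y\<rfloor> = 0\<close>, which is where the bounds on
  \<open>y\<close> enter.\<close>

lemma binary_digit_sums:
  assumes "0 \<le> y" "y < 1"
  shows "(\<lambda>k. of_int (binary_digit k y) / 2 ^ Suc k) sums y"
proof -
  have s: "(\<Sum>k<n. real_of_int (binary_digit k y) / 2 ^ Suc k) = of_int \<lfloor>2 ^ n * y\<rfloor> / 2 ^ n" for n
  proof (induction n)
    case 0
    show ?case using assms by (simp add: floor_eq_iff)
  next
    case (Suc n)
    then show ?case by (simp add: binary_digit_def field_simps)
  qed
  have "(\<lambda>n. of_int \<lfloor>2 ^ n * y\<rfloor> / 2 ^ n) \<longlonglongrightarrow> y"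
  proof (rule tendsto_sandwich)
    show "eventually (\<lambda>n. y - (1 / 2) ^ n \<le> of_int \<lfloor>2 ^ n * y\<rfloor> / 2 ^ n) sequentially"
    proof (intro always_eventually allI)
      fix n
      have "2 ^ n * y - 1 \<le> of_int \<lfloor>2 ^ n * y\<rfloor>" by linarith
      then have "(2 ^ n * y - 1) / 2 ^ n \<le> of_int \<lfloor>2 ^ n * y\<rfloor> / 2 ^ n"
        by (rule divide_right_mono) simp
      then show "y - (1 / 2) ^ n \<le> of_int \<lfloor>2 ^ n * y\<rfloor> / 2 ^ n"
        by (simp add: diff_divide_distrib power_one_over)
    qed
    show "eventually (\<lambda>n. of_int \<lfloor>2 ^ n * y\<rfloor> / 2 ^ n \<le> y) sequentially"
      by (intro always_eventually allI) (simp add: field_simps)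
    show "(\<lambda>n. y - (1 / 2) ^ n) \<longlonglongrightarrow> y"
      by (rule tendsto_eq_intros LIMSEQ_power_zero | simp)+
  qed simp
  then show ?thesis
    unfolding sums_def s .
qed

text \<open>Schoenberg's space-filling curve, here in the Hilbert cube. The \<open>k\<close>-th binary digit of the
  \<open>i\<close>-th coordinate is stored in the ternary digit of index \<open>prod_encode (i, k)\<close>, which \<^const>\<open>tooth\<close>
  reads off continuously.\<close>

definition schoenberg :: "nat \<Rightarrow> real \<Rightarrow> real" where
  "schoenberg i t = (\<Sum>k. tooth (3 ^ prod_encode (i, k) * t) / 2 ^ Suc k)"

definition schoenberg_inverse :: "(nat \<Rightarrow> real) \<Rightarrow> real" where
  "schoenberg_inverse y =
    cantor_sum (\<lambda>m. binary_digit (snd (prod_decode m)) (y (fst (prod_decode m))))"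

lemma continuous_on_schoenberg: "continuous_on UNIV (schoenberg i)"
proof -
  have "uniform_limit UNIV (\<lambda>n t. \<Sum>k<n. tooth (3 ^ prod_encode (i, k) * t) / 2 ^ Suc k)
     (\<lambda>t. \<Sum>k. tooth (3 ^ prod_encode (i, k) * t) / 2 ^ Suc k) sequentially"
  proof (rule Weierstrass_m_test)
    show "norm (tooth (3 ^ prod_encode (i, k) * t) / 2 ^ Suc k) \<le> (1 / 2) ^ Suc k" for k t
      by (simp add: tooth_def field_simps)
    show "summable (\<lambda>k. (1 / 2) ^ Suc k :: real)"
      by (intro summable_Suc_iff[THEN iffD2] summable_geometric) simp
  qed
  then show ?thesis
    unfolding schoenberg_def[abs_def]
    by (rule uniform_limit_theorem[rotated])
      (auto intro!: always_eventually continuous_intros simp: tooth_def)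
qed

lemma schoenberg_schoenberg_inverse:
  assumes "0 \<le> y i" "y i < 1"
  shows "schoenberg i (schoenberg_inverse y) = y i"
  unfolding schoenberg_def schoenberg_inverse_def
  using binary_digit_sums[OF assms, THEN sums_unique]
  by (subst tooth_cantor_sum) (simp_all add: binary_digit del: insert_iff)

lemma schoenberg_inverse_bounds:
  "0 \<le> schoenberg_inverse y" "schoenberg_inverse y \<le> 1"
  unfolding schoenberg_inverse_def
  by (intro cantor_sum_nonneg cantor_sum_le_1 binary_digit)+

text \<open>Binary digits jump, so this right inverse of the curve is not continuous. As a series in
  floors it is still Borel measurable, which is enough to push measures to the line.\<close>

lemma measurable_schoenberg_inverse:
  assumes [measurable]: "\<And>i. f i \<in> borel_measurable M"
  shows "(\<lambda>x. schoenberg_inverse (\<lambda>i. f i x)) \<in> borel_measurable M"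
  unfolding schoenberg_inverse_def cantor_sum_def binary_digit_def by measurable

section \<open>The whole space as an open cube, and its passage to the line and back\<close>

definition squash :: "real \<Rightarrow> real" where
  "squash x = 1 / 2 + arctan x / pi"

definition unsquash :: "real \<Rightarrow> real" where
  "unsquash y = tan (pi * (y - 1 / 2))"

lemma unsquash_squash: "unsquash (squash x) = x"
  by (simp add: squash_def unsquash_def tan_arctan)

lemma squash_bounds: "0 < squash x" "squash x < 1"
  using arctan_lbound[of x] arctan_ubound[of x] by (auto simp: squash_def field_simps)

lemma squash_mono: "x \<le> y \<Longrightarrow> squash x \<le> squash y"
  by (simp add: squash_def divide_right_mono arctan_le_iff)

lemma isCont_unsquash:
  assumes "0 < y" "y < 1"
  shows "isCont unsquash y"
proof -
  have "- pi / 2 < pi * (y - 1 / 2)" "pi * (y - 1 / 2) < pi / 2"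
    using assms by (simp_all add: field_simps)
  then have "cos (pi * (y - 1 / 2)) \<noteq> 0"
    using cos_gt_zero_pi[of "pi * (y - 1 / 2)"] by simp
  then show ?thesis unfolding unsquash_def by (intro continuous_intros) auto
qed

text \<open>Beyond the dimension \<open>from_nat_into\<close> returns some basis vector, so the
  remaining coordinates in the Hilbert cube are repetitions; \<open>from_line\<close> reads only the
  indices of basis vectors.\<close>

definition to_line :: "'a::euclidean_space \<Rightarrow> real" where
  "to_line x = schoenberg_inverse (\<lambda>i. squash (x \<bullet> from_nat_into Basis i))"

definition from_line :: "real \<Rightarrow> 'a::euclidean_space" where
  "from_line t = (\<Sum>b\<in>Basis. unsquash (schoenberg (to_nat_on (Basis :: 'a set) b) t) *\<^sub>R b)"

lemma schoenberg_to_line: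
  fixes x :: "'a::euclidean_space"
  assumes "b \<in> Basis"
  shows "schoenberg (to_nat_on (Basis :: 'a set) b) (to_line x) = squash (x \<bullet> b)"
proof -
  have "from_nat_into Basis (to_nat_on (Basis :: 'a set) b) = b"
    by (rule from_nat_into_to_nat_on) (simp_all add: assms countable_finite)
  then show ?thesis
    unfolding to_line_def
    by (subst schoenberg_schoenberg_inverse) (simp_all add: squash_bounds less_imp_le)
qed

lemma from_line_to_line: "from_line (to_line x) = x"
  by (simp add: from_line_def schoenberg_to_line unsquash_squash euclidean_representation)

lemma measurable_to_line [measurable]: "to_line \<in> borel_measurable borel"
  unfolding to_line_def[abs_def] squash_def
  by (intro measurable_schoenberg_inverse) measurable

lemma measurable_from_line [measurable]: "from_line \<in> borel_measurable borel"
proof -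
  have [measurable]: "schoenberg i \<in> borel_measurable borel" for i
    by (rule borel_measurable_continuous_onI[OF continuous_on_schoenberg])
  show ?thesis
    \<comment> \<open>Unfolded to a quotient, the tangent is measurable across its poles too, where
      division by 0 gives 0.\<close>
    unfolding from_line_def[abs_def] unsquash_def tan_def by measurable
qed

text \<open>Transport to the line, where Helly's and Skorohod's theorems are available, and back along the
  curve, which is continuous.\<close>

lemma bounded_second_moment_imp_AE_convergent_representation:
  fixes \<mu> :: "nat \<Rightarrow> 'a::euclidean_space measure"
  assumes P: "\<And>n. prob_space (\<mu> n)" and s: "\<And>n. sets (\<mu> n) = sets borel"
    and C: "\<And>n. (\<integral>\<^sup>+x. ennreal ((norm x)\<^sup>2) \<partial>\<mu> n) \<le> C" "C < \<infinity>"
  obtains r :: "nat \<Rightarrow> nat" and \<Omega> :: "real measure" and X :: "nat \<Rightarrow> real \<Rightarrow> 'a" and X' :: "real \<Rightarrow> 'a"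
  where "strict_mono r" "prob_space \<Omega>" "\<And>n. X n \<in> borel_measurable \<Omega>" "X' \<in> borel_measurable \<Omega>"
    "\<And>n. distr \<Omega> borel (X n) = \<mu> (r n)" "AE \<omega> in \<Omega>. (\<lambda>n. X n \<omega>) \<longlonglongrightarrow> X' \<omega>"
proof -
  have tm: "to_line \<in> borel_measurable (\<mu> n)" for n
    using measurable_to_line by (simp cong: measurable_cong_sets add: s)
  define M where "M n = distr (\<mu> n) borel to_line" for n
  have rd: "real_distribution (M n)" for n
    unfolding M_def using P tm by (intro prob_space.real_distribution_distr)
  \<comment> \<open>The image laws live on [0, 1], so tightness is automatic; a loss of mass at
    infinity would show up as approach to the faces of the cube. The half-open interval starts at -1
    in order to contain 0.\<close>
  have "tight M"
    unfolding tight_def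
  proof (intro conjI allI impI rd)
    fix e :: real assume e: "e > 0"
    have "measure (M n) {-1<..1} = 1" for n
    proof -
      interpret prob_space "\<mu> n" by (rule P)
      have "to_line -` {-1<..1} = (UNIV :: 'a set)"
        using schoenberg_inverse_bounds by (force simp: to_line_def less_le_trans[of "-1" 0])
      then show ?thesis
        unfolding M_def using prob_space by (simp add: measure_distr tm)
    qed
    then show "\<exists>a b. a < b \<and> (\<forall>n. 1 - e < measure (M n) {a<..b})"
      using e by (intro exI[of _ "-1"] exI[of _ 1]) auto
  qed
  from tight_imp_convergent_subsubsequence[OF this strict_mono_id] obtain r M'
    where r: "strict_mono (r :: nat \<Rightarrow> nat)" and M': "real_distribution M'" and w: "weak_conv_m (\<lambda>n. M (r n)) M'"
    by (auto simp: comp_def)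
  from Skorohod[OF rd M' w] obtain \<Omega> :: "real measure" and Y Y' where *: "prob_space \<Omega> \<and>
      (\<forall>n. Y n \<in> borel_measurable \<Omega>) \<and> (\<forall>n. distr \<Omega> borel (Y n) = M (r n)) \<and>
      Y' \<in> measurable \<Omega> lborel \<and> distr \<Omega> borel Y' = M' \<and>
      (\<forall>\<omega>\<in>space \<Omega>. (\<lambda>n. Y n \<omega>) \<longlonglongrightarrow> Y' \<omega>)"
    by blast
  then have O: "prob_space \<Omega>" and Ym [measurable]: "\<And>n. Y n \<in> borel_measurable \<Omega>"
      and Yd: "\<And>n. distr \<Omega> borel (Y n) = M (r n)"
      and Y'm: "Y' \<in> measurable \<Omega> lborel" and Yc: "\<And>\<omega>. \<omega> \<in> space \<Omega> \<Longrightarrow> (\<lambda>n. Y n \<omega>) \<longlonglongrightarrow> Y' \<omega>"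
    by simp_all
  have [measurable]: "Y' \<in> borel_measurable \<Omega>" using Y'm by simp
  interpret O: prob_space \<Omega> by (rule O)
  define X where "X n \<omega> = (from_line (Y n \<omega>) :: 'a)" for n \<omega>
  define X' where "X' \<omega> = (from_line (Y' \<omega>) :: 'a)" for \<omega>
  have Xm [measurable]: "X n \<in> borel_measurable \<Omega>" "X' \<in> borel_measurable \<Omega>" for n
    unfolding X_def[abs_def] X'_def[abs_def] by measurable
  have Xd: "distr \<Omega> borel (X n) = \<mu> (r n)" for n
  proof -
    have "distr \<Omega> borel (X n) = distr (distr \<Omega> borel (Y n)) borel from_line"
      by (subst distr_distr) (simp_all add: comp_def X_def[abs_def])
    also have "\<dots> = distr (\<mu> (r n)) borel (\<lambda>x. x)"
      unfolding Yd M_def by (subst distr_distr[OF measurable_from_line tm]) (simp add: comp_def from_line_to_line)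
    also have "\<dots> = \<mu> (r n)"
      by (rule distr_id2) (simp add: s)
    finally show ?thesis .
  qed
  have sm [measurable]: "schoenberg i \<in> borel_measurable borel" for i
    by (rule borel_measurable_continuous_onI[OF continuous_on_schoenberg])
  \<comment> \<open>The curve need not stay strictly inside the cube, but \<open>Y n\<close> has the
    law of an image under \<open>to_line\<close>, so almost surely its curve value is the squashed
    point \<open>X n \<omega>\<close>.\<close>
  have "AE \<omega> in \<Omega>. \<forall>b\<in>Basis. squash (X n \<omega> \<bullet> b) = schoenberg (to_nat_on (Basis :: 'a set) b) (Y n \<omega>)" for n
  proof -
    have "AE t in M (r n). \<forall>b\<in>Basis. squash ((from_line t :: 'a) \<bullet> b) = schoenberg (to_nat_on (Basis :: 'a set) b) t"
      unfolding M_def squash_def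
      by (subst AE_distr_iff[OF tm], measurable)
        (simp add: from_line_to_line schoenberg_to_line squash_def)
    then show ?thesis
      unfolding Yd[symmetric] squash_def X_def
      by (subst (asm) AE_distr_iff[OF Ym]) measurable
  qed
  then have eq: "AE \<omega> in \<Omega>. \<forall>n. \<forall>b\<in>Basis. squash (X n \<omega> \<bullet> b) = schoenberg (to_nat_on (Basis :: 'a set) b) (Y n \<omega>)"
    by (simp add: AE_all_countable)
  \<comment> \<open>By Fatou, almost every path has a finite limit inferior of norms and so returns
    infinitely often to some ball.\<close>
  have "(\<integral>\<^sup>+\<omega>. liminf (\<lambda>n. ennreal ((norm (X n \<omega>))\<^sup>2)) \<partial>\<Omega>)
      \<le> liminf (\<lambda>n. \<integral>\<^sup>+\<omega>. ennreal ((norm (X n \<omega>))\<^sup>2) \<partial>\<Omega>)"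
    by (rule nn_integral_liminf) measurable
  also have "\<dots> = liminf (\<lambda>n. \<integral>\<^sup>+x. ennreal ((norm x)\<^sup>2) \<partial>\<mu> (r n))"
    by (simp add: Xd[symmetric] nn_integral_distr)
  also have "\<dots> \<le> liminf (\<lambda>n. C)"
    by (intro Liminf_mono always_eventually allI C)
  also have "\<dots> = C"
    by (simp add: Liminf_const)
  finally have "(\<integral>\<^sup>+\<omega>. liminf (\<lambda>n. ennreal ((norm (X n \<omega>))\<^sup>2)) \<partial>\<Omega>) \<noteq> \<infinity>"
    using C(2) by (auto simp: top_unique)
  then have fin: "AE \<omega> in \<Omega>. liminf (\<lambda>n. ennreal ((norm (X n \<omega>))\<^sup>2)) \<noteq> \<infinity>"
    by (intro nn_integral_PInf_AE) measurable
  have "AE \<omega> in \<Omega>. (\<lambda>n. X n \<omega>) \<longlonglongrightarrow> X' \<omega>"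
    using eq fin AE_space
  proof eventually_elim
    case (elim \<omega>)
    obtain K where K: "liminf (\<lambda>n. ennreal ((norm (X n \<omega>))\<^sup>2)) = ennreal K" "0 \<le> K"
      using elim(2) by (cases "liminf (\<lambda>n. ennreal ((norm (X n \<omega>))\<^sup>2))") auto
    \<comment> \<open>\<open>K\<close> is the limit inferior of the squared norms; the added 1 makes
      the comparison strict, so that the bound \<open>R\<close> holds infinitely often.\<close>
    define R where "R = sqrt (K + 1)"
    have "liminf (\<lambda>n. ennreal ((norm (X n \<omega>))\<^sup>2)) < ennreal (K + 1)"
      using K by (simp add: ennreal_less_iff)
    then have "\<not> (\<forall>\<^sub>F n in sequentially. ennreal (K + 1) \<le> ennreal ((norm (X n \<omega>))\<^sup>2))"
      using Liminf_bounded[of "ennreal (K + 1)"] by (metis not_le)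
    then have "\<exists>\<^sub>F n in sequentially. norm (X n \<omega>) \<le> R"
      unfolding frequently_def
    proof (rule contrapos_nn)
      assume "\<forall>\<^sub>F n in sequentially. \<not> norm (X n \<omega>) \<le> R"
      then show "\<forall>\<^sub>F n in sequentially. ennreal (K + 1) \<le> ennreal ((norm (X n \<omega>))\<^sup>2)"
      proof eventually_elim
        case (elim n)
        then show ?case
          using K(2) by (intro ennreal_leI) (auto simp: R_def not_le intro: sqrt_le_D less_imp_le)
      qed
    qed
    note freq = this
    have "(\<lambda>n. unsquash (schoenberg (to_nat_on (Basis :: 'a set) b) (Y n \<omega>)))
        \<longlonglongrightarrow> unsquash (schoenberg (to_nat_on (Basis :: 'a set) b) (Y' \<omega>))"
      if b: "b \<in> Basis" for b :: 'a
    proof -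
      let ?f = "schoenberg (to_nat_on (Basis :: 'a set) b)"
      have lim: "(\<lambda>n. ?f (Y n \<omega>)) \<longlonglongrightarrow> ?f (Y' \<omega>)"
        using continuous_on_schoenberg Yc[OF elim(3)]
        by (intro isCont_tendsto_compose[of _ ?f]) (auto simp: continuous_on_eq_continuous_at)
      \<comment> \<open>A bound at infinitely many indices suffices, since the full sequence of
        curve values already converges: its limit lies in a closed interval inside (0, 1), where
        \<open>unsquash\<close> is continuous.\<close>
      have "\<exists>\<^sub>F n in sequentially. ?f (Y n \<omega>) \<in> {squash (- R)..squash R}"
        using freq
      proof (rule frequently_elim1)
        fix n assume "norm (X n \<omega>) \<le> R"
        then have "\<bar>X n \<omega> \<bullet> b\<bar> \<le> R" using Basis_le_norm[OF b, of "X n \<omega>"] by simp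
        then show "?f (Y n \<omega>) \<in> {squash (- R)..squash R}"
          using elim(1) b by (metis abs_le_D1 abs_le_D2 atLeastAtMost_iff minus_le_iff squash_mono)
      qed
      moreover have "\<forall>\<^sub>F n in sequentially. ?f (Y n \<omega>) \<in> - {squash (- R)..squash R}"
        if "?f (Y' \<omega>) \<notin> {squash (- R)..squash R}"
        using that by (intro topological_tendstoD[OF lim]) (auto intro: open_Compl)
      ultimately have "?f (Y' \<omega>) \<in> {squash (- R)..squash R}"
        unfolding frequently_def by auto
      then have "0 < ?f (Y' \<omega>)" "?f (Y' \<omega>) < 1"
        using squash_bounds[of R] squash_bounds[of "- R"] by auto
      then show ?thesis
        by (intro isCont_tendsto_compose[OF isCont_unsquash lim])
    qed
    then show ?case
      unfolding X_def X'_def from_line_def by (intro tendsto_intros)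
  qed
  with that[OF r O Xm Xd] show thesis by blast
qed

subsection \<open>The sliced Wasserstein metric\<close>

text \<open>Minkowski's inequality in terms of bounds \<open>a\<close> and \<open>b\<close>. With
  the weights \<open>1 + B / A\<close> and \<open>1 + A / B\<close>, the weighted sum of
  \<open>A\<^sup>2\<close> and \<open>B\<^sup>2\<close> is exactly \<open>(A + B)\<^sup>2\<close>.
  The shift by \<open>e\<close> keeps the quotients meaningful when \<open>a\<close> or
  \<open>b\<close> is 0, and \<open>e\<close> tends to 0 at the end.\<close>

lemma nn_integral_square_triangle:
  fixes f g h :: "'b \<Rightarrow> real"
  assumes [measurable]: "f \<in> borel_measurable M" "g \<in> borel_measurable M"
    and le: "\<And>x. \<bar>h x\<bar> \<le> f x + g x"
    and f: "(\<integral>\<^sup>+x. ennreal ((f x)\<^sup>2) \<partial>M) \<le> ennreal (a\<^sup>2)" and g: "(\<integral>\<^sup>+x. ennreal ((g x)\<^sup>2) \<partial>M) \<le> ennreal (b\<^sup>2)"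
    and a: "0 \<le> a" and b: "0 \<le> b"
  shows "(\<integral>\<^sup>+x. ennreal ((h x)\<^sup>2) \<partial>M) \<le> ennreal ((a + b)\<^sup>2)"
proof -
  have *: "(\<integral>\<^sup>+x. ennreal ((h x)\<^sup>2) \<partial>M) \<le> ennreal ((a + b + 2 * e)\<^sup>2)" if e: "e > 0" for e
  proof -
    define A B where "A = a + e" and "B = b + e"
    have AB: "A > 0" "B > 0" "a\<^sup>2 \<le> A\<^sup>2" "b\<^sup>2 \<le> B\<^sup>2"
      using a b e by (auto simp: A_def B_def intro!: power_mono)
    have pt: "(h x)\<^sup>2 \<le> (1 + B / A) * (f x)\<^sup>2 + (1 + A / B) * (g x)\<^sup>2" for x
    proof -
      have "(h x)\<^sup>2 \<le> (f x + g x)\<^sup>2"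
        using power_mono[OF le, of x 2] by simp
      also have "\<dots> = (1 + B / A) * (f x)\<^sup>2 + (1 + A / B) * (g x)\<^sup>2 - (B * f x - A * g x)\<^sup>2 / (A * B)"
        using AB by (simp add: field_simps power2_eq_square)
      also have "\<dots> \<le> (1 + B / A) * (f x)\<^sup>2 + (1 + A / B) * (g x)\<^sup>2"
        using AB by simp
      finally show ?thesis .
    qed
    have "(\<integral>\<^sup>+x. ennreal ((h x)\<^sup>2) \<partial>M)
        \<le> (\<integral>\<^sup>+x. ennreal (1 + B / A) * ennreal ((f x)\<^sup>2) + ennreal (1 + A / B) * ennreal ((g x)\<^sup>2) \<partial>M)"
      using pt AB by (intro nn_integral_mono) (simp flip: ennreal_mult ennreal_plus add: ennreal_leI)
    also have "\<dots> = ennreal (1 + B / A) * (\<integral>\<^sup>+x. ennreal ((f x)\<^sup>2) \<partial>M) + ennreal (1 + A / B) * (\<integral>\<^sup>+x. ennreal ((g x)\<^sup>2) \<partial>M)"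
      by (simp add: nn_integral_add nn_integral_cmult)
    also have "\<dots> \<le> ennreal (1 + B / A) * ennreal (A\<^sup>2) + ennreal (1 + A / B) * ennreal (B\<^sup>2)"
      using AB f g by (intro add_mono mult_left_mono order_trans[OF f] order_trans[OF g] ennreal_leI) auto
    also have "\<dots> = ennreal ((1 + B / A) * A\<^sup>2 + (1 + A / B) * B\<^sup>2)"
      using AB by (simp flip: ennreal_mult ennreal_plus)
    also have "(1 + B / A) * A\<^sup>2 + (1 + A / B) * B\<^sup>2 = (a + b + 2 * e)\<^sup>2"
      using AB by (simp add: field_simps power2_eq_square) (simp add: A_def B_def algebra_simps)
    finally show ?thesis .
  qed
  have "(\<lambda>n. ennreal ((a + b + 2 * inverse (real (Suc n)))\<^sup>2)) \<longlonglongrightarrow> ennreal ((a + b + 2 * 0)\<^sup>2)"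
    by (intro tendsto_ennrealI tendsto_intros LIMSEQ_inverse_real_of_nat)
  then show ?thesis
    using LIMSEQ_le_const[of "\<lambda>n. ennreal ((a + b + 2 * inverse (real (Suc n)))\<^sup>2)"] * by auto
qed

text \<open>Cruder than Minkowski's inequality but meaningful for infinite integrals; it yields the
  finiteness of costs and the bounds on moments.\<close>

lemma nn_integral_square_le_twice:
  fixes f g h :: "'b \<Rightarrow> real"
  assumes [measurable]: "f \<in> borel_measurable M" "g \<in> borel_measurable M"
    and le: "\<And>x. \<bar>h x\<bar> \<le> \<bar>f x\<bar> + \<bar>g x\<bar>"
  shows "(\<integral>\<^sup>+x. ennreal ((h x)\<^sup>2) \<partial>M)
    \<le> 2 * (\<integral>\<^sup>+x. ennreal ((f x)\<^sup>2) \<partial>M) + 2 * (\<integral>\<^sup>+x. ennreal ((g x)\<^sup>2) \<partial>M)"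
proof -
  have pt: "(h x)\<^sup>2 \<le> 2 * (f x)\<^sup>2 + 2 * (g x)\<^sup>2" for x
  proof -
    have "(h x)\<^sup>2 \<le> (\<bar>f x\<bar> + \<bar>g x\<bar>)\<^sup>2"
      using power_mono[OF le, of x 2] by simp
    also have "\<dots> = 2 * (f x)\<^sup>2 + 2 * (g x)\<^sup>2 - (\<bar>f x\<bar> - \<bar>g x\<bar>)\<^sup>2"
      by (simp add: power2_eq_square algebra_simps flip: abs_mult)
    finally show ?thesis
      using zero_le_power2[of "\<bar>f x\<bar> - \<bar>g x\<bar>"] by linarith
  qed
  have "ennreal ((h x)\<^sup>2) \<le> 2 * ennreal ((f x)\<^sup>2) + 2 * ennreal ((g x)\<^sup>2)" for x
  proof -
    have "ennreal ((h x)\<^sup>2) \<le> ennreal (2 * (f x)\<^sup>2 + 2 * (g x)\<^sup>2)"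
      by (rule ennreal_leI[OF pt])
    then show ?thesis by (simp add: ennreal_mult')
  qed
  then have "(\<integral>\<^sup>+x. ennreal ((h x)\<^sup>2) \<partial>M) \<le> (\<integral>\<^sup>+x. 2 * ennreal ((f x)\<^sup>2) + 2 * ennreal ((g x)\<^sup>2) \<partial>M)"
    by (intro nn_integral_mono)
  also have "\<dots> = 2 * (\<integral>\<^sup>+x. ennreal ((f x)\<^sup>2) \<partial>M) + 2 * (\<integral>\<^sup>+x. ennreal ((g x)\<^sup>2) \<partial>M)"
    by (simp add: nn_integral_add nn_integral_cmult)
  finally show ?thesis .
qed

lemma Liminf_cmult_ennreal:
  fixes f :: "nat \<Rightarrow> ennreal"
  assumes "c < \<infinity>"
  shows "liminf (\<lambda>n. c * f n) = c * liminf f"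
  using assms
  by (intro Liminf_compose_continuous_mono ennreal_continuous_on_cmult continuous_on_id)
    (auto simp: mono_def mult_left_mono)

lemma measurable_cdf [measurable]:
  assumes "real_distribution M"
  shows "cdf M \<in> borel_measurable borel"
proof -
  interpret cdf_distribution M unfolding cdf_distribution_def by fact
  show ?thesis by (rule measurable_C)
qed

text \<open>Distribution functions converge off the atoms of the limit, a countable set, so the
  integrand converges for almost every \<open>s\<close> and then almost every \<open>t\<close>.
  Fatou is applied to the inner and to the outer integral.\<close>

lemma cdf_cost_le_liminf:
  assumes N: "real_distribution N" and M: "\<And>n. real_distribution (M n)" and M': "real_distribution M'"
    and w: "weak_conv_m M M'"
  shows "cdf_cost N M' \<le> liminf (\<lambda>n. cdf_cost N (M n))"
proof -
  interpret N: real_distribution N by fact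
  interpret M': real_distribution M' by fact
  interpret M: real_distribution "M n" for n by fact
  note [measurable] = measurable_cdf[OF N] measurable_cdf[OF M] measurable_cdf[OF M']
  let ?k = "\<lambda>A s t. if s \<le> t then ennreal (cdf N s - cdf A t) + ennreal (cdf A s - cdf N t) else 0"
  have conv: "AE t in lborel. (\<lambda>n. cdf (M n) t) \<longlonglongrightarrow> cdf M' t"
  proof -
    have "AE t in lborel. t \<notin> {t. measure M' {t} \<noteq> 0}"
      using M'.countable_support by (intro AE_not_in countable_imp_null_set_lborel)
    then show ?thesis
      by eventually_elim (use w M'.isCont_cdf in \<open>auto simp: weak_conv_m_def weak_conv_def\<close>)
  qed
  have "(\<integral>\<^sup>+s. \<integral>\<^sup>+t. ?k M' s t \<partial>lborel \<partial>lborel)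
      \<le> (\<integral>\<^sup>+s. liminf (\<lambda>n. \<integral>\<^sup>+t. ?k (M n) s t \<partial>lborel) \<partial>lborel)"
  proof (rule nn_integral_mono_AE)
    show "AE s in lborel. (\<integral>\<^sup>+t. ?k M' s t \<partial>lborel) \<le> liminf (\<lambda>n. \<integral>\<^sup>+t. ?k (M n) s t \<partial>lborel)"
      using conv
    proof eventually_elim
      case (elim s)
      have "(\<integral>\<^sup>+t. ?k M' s t \<partial>lborel) \<le> (\<integral>\<^sup>+t. liminf (\<lambda>n. ?k (M n) s t) \<partial>lborel)"
      proof (rule nn_integral_mono_AE)
        show "AE t in lborel. ?k M' s t \<le> liminf (\<lambda>n. ?k (M n) s t)"
          using conv
        proof eventually_elim
          case (elim t)
          have "(\<lambda>n. ?k (M n) s t) \<longlonglongrightarrow> ?k M' s t"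
            using elim \<open>(\<lambda>n. cdf (M n) s) \<longlonglongrightarrow> cdf M' s\<close>
            by (cases "s \<le> t") (auto intro!: tendsto_intros)
          then show ?case
            by (simp only: lim_imp_Liminf[OF trivial_limit_sequentially] order_refl)
        qed
      qed
      also have "\<dots> \<le> liminf (\<lambda>n. \<integral>\<^sup>+t. ?k (M n) s t \<partial>lborel)"
        by (rule nn_integral_liminf) measurable
      finally show ?case .
    qed
  qed
  also have "\<dots> \<le> liminf (\<lambda>n. \<integral>\<^sup>+s. \<integral>\<^sup>+t. ?k (M n) s t \<partial>lborel \<partial>lborel)"
    by (rule nn_integral_liminf) measurable
  finally show ?thesis
    unfolding cdf_cost_def by (subst Liminf_cmult_ennreal) (auto intro: mult_left_mono)
qed

section \<open>Costs of projections and the sliced distance as their average\<close>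

abbreviation proj_cost :: "'a::euclidean_space measure \<Rightarrow> 'a measure \<Rightarrow> 'a \<Rightarrow> ennreal" where
  "proj_cost \<mu> \<nu> \<theta> \<equiv> cdf_cost (proj_measure \<theta> \<mu>) (proj_measure \<theta> \<nu>)"

lemma P2_D:
  assumes "\<mu> \<in> P2"
  shows "prob_space \<mu>" "sets \<mu> = sets borel" "(\<integral>\<^sup>+ x. ennreal ((norm x)\<^sup>2) \<partial>\<mu>) < \<infinity>"
  using assms by (auto simp: P2_def)

lemma measurable_P2:
  assumes "\<mu> \<in> P2" "f \<in> borel_measurable borel"
  shows "f \<in> borel_measurable \<mu>"
  using assms(2) measurable_cong_sets[OF P2_D(2)[OF assms(1)] refl] by blast

lemma real_distribution_proj_measure:
  assumes "\<mu> \<in> P2"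
  shows "real_distribution (proj_measure \<theta> \<mu>)"
  unfolding proj_measure_def
  by (intro prob_space.real_distribution_distr P2_D assms measurable_P2[OF assms]) measurable

text \<open>The distribution function is the integral over \<open>x\<close> of an indicator that is
  jointly measurable in \<open>x\<close>, direction and level.\<close>

lemma measurable_cdf_proj_measure:
  assumes \<mu>: "\<mu> \<in> P2"
  shows "(\<lambda>(\<theta>, s). cdf (proj_measure \<theta> \<mu>) s) \<in> borel_measurable (borel \<Otimes>\<^sub>M borel)"
proof -
  interpret prob_space \<mu> by (rule P2_D[OF \<mu>])
  have [measurable_cong]: "sets \<mu> = sets borel" by (rule P2_D[OF \<mu>])
  have sp: "space \<mu> = UNIV" using sets_eq_imp_space_eq[OF P2_D(2)[OF \<mu>]] by simp
  have "cdf (proj_measure \<theta> \<mu>) s = enn2real (\<integral>\<^sup>+x. (if x \<bullet> \<theta> \<le> s then 1 else 0) \<partial>\<mu>)" for \<theta> s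
  proof -
    have "(\<integral>\<^sup>+x. (if x \<bullet> \<theta> \<le> s then 1 else 0) \<partial>\<mu>) = (\<integral>\<^sup>+x. indicator {x. x \<bullet> \<theta> \<le> s} x \<partial>\<mu>)"
      by (intro nn_integral_cong) auto
    also have "\<dots> = emeasure \<mu> {x. x \<bullet> \<theta> \<le> s}"
      by (rule nn_integral_indicator) measurable
    finally show ?thesis
      by (simp add: cdf_def proj_measure_def measure_def emeasure_distr sp vimage_def)
  qed
  moreover have "(\<lambda>(\<theta>, s). enn2real (\<integral>\<^sup>+x. (if x \<bullet> \<theta> \<le> s then 1 else 0) \<partial>\<mu>)) \<in> borel_measurable (borel \<Otimes>\<^sub>M borel)"
    by measurable
  ultimately show ?thesis by simp
qed

lemma measurable_proj_cost:
  assumes \<mu>: "\<mu> \<in> P2" and \<nu>: "\<nu> \<in> P2"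
  shows "proj_cost \<mu> \<nu> \<in> borel_measurable borel"
proof -
  have F [measurable]: "(\<lambda>x. cdf (proj_measure (f x) \<rho>) (g x)) \<in> borel_measurable M"
    if "f \<in> borel_measurable M" "g \<in> borel_measurable M" "\<rho> \<in> P2"
    for f :: "'b \<Rightarrow> 'a" and g \<rho> and M :: "'b measure"
    using measurable_compose[OF measurable_Pair[OF that(1,2)] measurable_cdf_proj_measure[OF that(3)]]
    by simp
  show ?thesis
    unfolding cdf_cost_def using \<mu> \<nu> by measurable
qed

lemma nn_integral_quantile_proj_measure:
  assumes \<mu>: "\<mu> \<in> P2"
  shows "(\<integral>\<^sup>+u. ennreal ((quantile (proj_measure \<theta> \<mu>) u)\<^sup>2) \<partial>unit_lebesgue)
    = (\<integral>\<^sup>+x. ennreal ((x \<bullet> \<theta>)\<^sup>2) \<partial>\<mu>)"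
proof -
  note rd = real_distribution_proj_measure[OF \<mu>, of \<theta>]
  have "(\<integral>\<^sup>+u. ennreal ((quantile (proj_measure \<theta> \<mu>) u)\<^sup>2) \<partial>unit_lebesgue)
      = (\<integral>\<^sup>+y. ennreal (y\<^sup>2) \<partial>distr unit_lebesgue borel (quantile (proj_measure \<theta> \<mu>)))"
    by (rule nn_integral_distr[OF measurable_quantile[OF rd], symmetric]) measurable
  also have "\<dots> = (\<integral>\<^sup>+y. ennreal (y\<^sup>2) \<partial>proj_measure \<theta> \<mu>)"
    by (simp only: distr_quantile[OF rd])
  also have "\<dots> = (\<integral>\<^sup>+x. ennreal ((x \<bullet> \<theta>)\<^sup>2) \<partial>\<mu>)"
    unfolding proj_measure_def by (intro nn_integral_distr measurable_P2[OF \<mu>]) measurable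
  finally show ?thesis .
qed

lemma proj_cost_le:
  assumes \<mu>: "\<mu> \<in> P2" and \<nu>: "\<nu> \<in> P2"
  shows "proj_cost \<mu> \<nu> \<theta> \<le> 2 * (\<integral>\<^sup>+x. ennreal ((x \<bullet> \<theta>)\<^sup>2) \<partial>\<mu>) + 2 * (\<integral>\<^sup>+x. ennreal ((x \<bullet> \<theta>)\<^sup>2) \<partial>\<nu>)"
  unfolding cdf_cost_eq_quantile[OF real_distribution_proj_measure[OF \<mu>] real_distribution_proj_measure[OF \<nu>]]
    nn_integral_quantile_proj_measure[OF \<mu>, symmetric] nn_integral_quantile_proj_measure[OF \<nu>, symmetric]
  by (intro nn_integral_square_le_twice measurable_quantile real_distribution_proj_measure assms) simp

text \<open>In \<open>L2\<close>, the quantile function of one projection is its difference to the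
  other plus the other; a small cost therefore transfers a moment bound.\<close>

lemma second_moment_proj_le:
  assumes \<mu>: "\<mu> \<in> P2" and \<nu>: "\<nu> \<in> P2"
  shows "(\<integral>\<^sup>+x. ennreal ((x \<bullet> \<theta>)\<^sup>2) \<partial>\<mu>) \<le> 2 * proj_cost \<mu> \<nu> \<theta> + 2 * (\<integral>\<^sup>+x. ennreal ((x \<bullet> \<theta>)\<^sup>2) \<partial>\<nu>)"
  unfolding cdf_cost_eq_quantile[OF real_distribution_proj_measure[OF \<mu>] real_distribution_proj_measure[OF \<nu>]]
    nn_integral_quantile_proj_measure[OF \<mu>, symmetric] nn_integral_quantile_proj_measure[OF \<nu>, symmetric]
  by (intro nn_integral_square_le_twice borel_measurable_diff measurable_quantile
      real_distribution_proj_measure assms) simp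

lemma nn_integral_inner_square_le:
  "(\<integral>\<^sup>+x. ennreal ((x \<bullet> \<theta>)\<^sup>2) \<partial>\<mu>) \<le> ennreal ((norm \<theta>)\<^sup>2) * (\<integral>\<^sup>+x. ennreal ((norm x)\<^sup>2) \<partial>\<mu>)"
  if \<mu>: "\<mu> \<in> P2" for \<theta> :: "'a::euclidean_space"
proof -
  have "(\<integral>\<^sup>+x. ennreal ((x \<bullet> \<theta>)\<^sup>2) \<partial>\<mu>) \<le> (\<integral>\<^sup>+x. ennreal ((norm \<theta>)\<^sup>2) * ennreal ((norm x)\<^sup>2) \<partial>\<mu>)"
  proof (rule nn_integral_mono)
    fix x :: 'a
    have "(x \<bullet> \<theta>)\<^sup>2 \<le> (norm \<theta>)\<^sup>2 * (norm x)\<^sup>2"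
      using power_mono[OF Cauchy_Schwarz_ineq2[of x \<theta>], of 2] by (simp add: power_mult_distrib mult.commute)
    then show "ennreal ((x \<bullet> \<theta>)\<^sup>2) \<le> ennreal ((norm \<theta>)\<^sup>2) * ennreal ((norm x)\<^sup>2)"
      by (simp flip: ennreal_mult add: ennreal_leI)
  qed
  also have "\<dots> = ennreal ((norm \<theta>)\<^sup>2) * (\<integral>\<^sup>+x. ennreal ((norm x)\<^sup>2) \<partial>\<mu>)"
    by (intro nn_integral_cmult measurable_P2[OF \<mu>]) measurable
  finally show ?thesis .
qed

lemma proj_cost_finite:
  assumes "\<mu> \<in> P2" "\<nu> \<in> P2"
  shows "proj_cost \<mu> \<nu> \<theta> < \<infinity>"
proof -
  have "(\<integral>\<^sup>+x. ennreal ((x \<bullet> \<theta>)\<^sup>2) \<partial>\<rho>) < \<infinity>" if "\<rho> \<in> P2" for \<rho>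
    using nn_integral_inner_square_le[OF that, of \<theta>] P2_D(3)[OF that]
    by (auto intro: le_less_trans simp: ennreal_mult_less_top)
  with assms show ?thesis
    by (intro le_less_trans[OF proj_cost_le[OF assms]]) (simp add: ennreal_mult_less_top)
qed

lemma ennreal_wasserstein2_proj:
  assumes "\<mu> \<in> P2" "\<nu> \<in> P2"
  shows "ennreal ((wasserstein2 (proj_measure \<theta> \<mu>) (proj_measure \<theta> \<nu>))\<^sup>2) = proj_cost \<mu> \<nu> \<theta>"
  using proj_cost_finite[OF assms, of \<theta>]
  by (simp add: wasserstein2_real real_distribution_proj_measure assms)

lemma wasserstein2_nonneg: "0 \<le> wasserstein2 \<mu> \<nu>"
  by (simp add: wasserstein2_def)

lemma wasserstein2_eq_sqrt:
  assumes "\<mu> \<in> P2" "\<nu> \<in> P2"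
  shows "wasserstein2 (proj_measure \<theta> \<mu>) (proj_measure \<theta> \<nu>) = sqrt (enn2real (proj_cost \<mu> \<nu> \<theta>))"
  using wasserstein2_real[OF real_distribution_proj_measure[OF assms(1)] real_distribution_proj_measure[OF assms(2)], of \<theta> \<theta>]
    wasserstein2_nonneg by (metis real_sqrt_unique)

lemma measurable_wasserstein2_proj:
  assumes "\<mu> \<in> P2" "\<nu> \<in> P2"
  shows "(\<lambda>\<theta>. wasserstein2 (proj_measure \<theta> \<mu>) (proj_measure \<theta> \<nu>)) \<in> borel_measurable borel"
  unfolding wasserstein2_eq_sqrt[OF assms] using measurable_proj_cost[OF assms] by measurable

lemma wasserstein2_proj_triangle:
  assumes \<mu>: "\<mu> \<in> P2" and \<nu>: "\<nu> \<in> P2" and \<rho>: "\<rho> \<in> P2"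
  shows "wasserstein2 (proj_measure \<theta> \<mu>) (proj_measure \<theta> \<rho>)
    \<le> wasserstein2 (proj_measure \<theta> \<mu>) (proj_measure \<theta> \<nu>) + wasserstein2 (proj_measure \<theta> \<nu>) (proj_measure \<theta> \<rho>)"
proof -
  let ?q = "\<lambda>\<mu>. quantile (proj_measure \<theta> \<mu>)"
  have rd: "real_distribution (proj_measure \<theta> \<mu>)" if "\<mu> \<in> P2" for \<mu>
    using that by (rule real_distribution_proj_measure)
  note [measurable] = measurable_quantile[OF rd[OF \<mu>]] measurable_quantile[OF rd[OF \<nu>]] measurable_quantile[OF rd[OF \<rho>]]
  have W: "(\<integral>\<^sup>+u. ennreal ((?q \<mu> u - ?q \<nu> u)\<^sup>2) \<partial>unit_lebesgue)
      = ennreal ((wasserstein2 (proj_measure \<theta> \<mu>) (proj_measure \<theta> \<nu>))\<^sup>2)" if "\<mu> \<in> P2" "\<nu> \<in> P2" for \<mu> \<nu>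
    using that by (simp add: ennreal_wasserstein2_proj cdf_cost_eq_quantile rd)
  have "(\<integral>\<^sup>+u. ennreal ((?q \<mu> u - ?q \<rho> u)\<^sup>2) \<partial>unit_lebesgue)
      \<le> ennreal ((wasserstein2 (proj_measure \<theta> \<mu>) (proj_measure \<theta> \<nu>)
          + wasserstein2 (proj_measure \<theta> \<nu>) (proj_measure \<theta> \<rho>))\<^sup>2)"
  proof (rule nn_integral_square_triangle[where f = "\<lambda>u. \<bar>?q \<mu> u - ?q \<nu> u\<bar>" and g = "\<lambda>u. \<bar>?q \<nu> u - ?q \<rho> u\<bar>"])
    show "(\<lambda>u. \<bar>?q \<mu> u - ?q \<nu> u\<bar>) \<in> borel_measurable unit_lebesgue"
      "(\<lambda>u. \<bar>?q \<nu> u - ?q \<rho> u\<bar>) \<in> borel_measurable unit_lebesgue"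
      by measurable
  qed (use W \<mu> \<nu> \<rho> wasserstein2_nonneg in auto)
  then have "(wasserstein2 (proj_measure \<theta> \<mu>) (proj_measure \<theta> \<rho>))\<^sup>2
      \<le> (wasserstein2 (proj_measure \<theta> \<mu>) (proj_measure \<theta> \<nu>) + wasserstein2 (proj_measure \<theta> \<nu>) (proj_measure \<theta> \<rho>))\<^sup>2"
    by (simp add: W \<mu> \<rho>)
  then show ?thesis
    by (rule power2_le_imp_le) (simp add: wasserstein2_nonneg)
qed

lemma sets_sphere_uniform [measurable_cong]: "sets sphere_uniform = sets borel"
  by (simp add: sphere_uniform_def)

lemma borel_measurable_sphere_uniform:
  "borel_measurable sphere_uniform = borel_measurable borel"
  by (rule measurable_cong_sets) (simp_all add: sets_sphere_uniform)

lemma nn_integral_sphere_uniform_proj_le: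
  assumes \<mu>: "\<mu> \<in> P2"
  shows "(\<integral>\<^sup>+\<theta>. \<integral>\<^sup>+x. ennreal ((x \<bullet> \<theta>)\<^sup>2) \<partial>\<mu> \<partial>sphere_uniform) \<le> (\<integral>\<^sup>+x. ennreal ((norm x)\<^sup>2) \<partial>\<mu>)"
proof -
  interpret prob_space "sphere_uniform :: 'a measure" by (rule prob_space_sphere_uniform)
  have "(\<integral>\<^sup>+\<theta>. \<integral>\<^sup>+x. ennreal ((x \<bullet> \<theta>)\<^sup>2) \<partial>\<mu> \<partial>sphere_uniform)
      \<le> (\<integral>\<^sup>+\<theta>. (\<integral>\<^sup>+x. ennreal ((norm x)\<^sup>2) \<partial>\<mu>) \<partial>(sphere_uniform :: 'a measure))"
  proof (rule nn_integral_mono_AE)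
    show "AE \<theta> in sphere_uniform. (\<integral>\<^sup>+x. ennreal ((x \<bullet> \<theta>)\<^sup>2) \<partial>\<mu>) \<le> (\<integral>\<^sup>+x. ennreal ((norm x)\<^sup>2) \<partial>\<mu>)"
      using AE_sphere_uniform
    proof eventually_elim
      case (elim \<theta>)
      then show ?case using nn_integral_inner_square_le[OF \<mu>, of \<theta>] by simp
    qed
  qed
  then show ?thesis by (simp add: emeasure_space_1)
qed

text \<open>Replaces the real-valued integral by one in \<open>ennreal\<close>, where Fubini and
  Fatou apply freely. Finiteness, from the projected second moments, is essential: an infinite
  integral would appear as 0 on the left.\<close>

lemma ennreal_SW_square:
  fixes \<mu> \<nu> :: "'a::euclidean_space measure"
  assumes \<mu>: "\<mu> \<in> P2" and \<nu>: "\<nu> \<in> P2"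
  shows "ennreal ((SW \<mu> \<nu>)\<^sup>2) = (\<integral>\<^sup>+\<theta>. proj_cost \<mu> \<nu> \<theta> \<partial>sphere_uniform)"
proof -
  let ?w = "\<lambda>\<theta>. (wasserstein2 (proj_measure \<theta> \<mu>) (proj_measure \<theta> \<nu>))\<^sup>2"
  have [measurable]: "?w \<in> borel_measurable sphere_uniform"
    using measurable_wasserstein2_proj[OF \<mu> \<nu>]
    by (intro borel_measurable_power) (simp add: borel_measurable_sphere_uniform)
  have [measurable]: "sphere (0::'a) 1 \<in> sets sphere_uniform"
    by (simp add: sets_sphere_uniform)
  have [measurable_cong]: "sets \<mu> = sets borel" "sets \<nu> = sets borel"
    using \<mu> \<nu> by (auto dest: P2_D)
  interpret m: prob_space \<mu> by (rule P2_D[OF \<mu>])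
  interpret n: prob_space \<nu> by (rule P2_D[OF \<nu>])
  have "(LINT \<theta>:sphere 0 1|sphere_uniform. ?w \<theta>) = (LINT \<theta>|sphere_uniform. ?w \<theta>)"
    unfolding set_lebesgue_integral_def
  proof (rule integral_cong_AE)
    show "AE \<theta> in sphere_uniform. indicator (sphere 0 1) \<theta> *\<^sub>R ?w \<theta> = ?w \<theta>"
      using AE_sphere_uniform by eventually_elim simp
  qed simp_all
  also have "\<dots> = enn2real (\<integral>\<^sup>+\<theta>. ennreal (?w \<theta>) \<partial>sphere_uniform)"
    by (rule integral_eq_nn_integral) auto
  also have "(\<lambda>\<theta>. ennreal (?w \<theta>)) = proj_cost \<mu> \<nu>"
    by (simp add: ennreal_wasserstein2_proj \<mu> \<nu>)
  finally have SW: "(SW \<mu> \<nu>)\<^sup>2 = enn2real (\<integral>\<^sup>+\<theta>. proj_cost \<mu> \<nu> \<theta> \<partial>sphere_uniform)"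
    unfolding SW_def by simp
  have "(\<integral>\<^sup>+\<theta>. proj_cost \<mu> \<nu> \<theta> \<partial>sphere_uniform)
      \<le> (\<integral>\<^sup>+\<theta>. 2 * (\<integral>\<^sup>+x. ennreal ((x \<bullet> \<theta>)\<^sup>2) \<partial>\<mu>) + 2 * (\<integral>\<^sup>+x. ennreal ((x \<bullet> \<theta>)\<^sup>2) \<partial>\<nu>) \<partial>sphere_uniform)"
    by (intro nn_integral_mono proj_cost_le \<mu> \<nu>)
  also have "\<dots> = 2 * (\<integral>\<^sup>+\<theta>. \<integral>\<^sup>+x. ennreal ((x \<bullet> \<theta>)\<^sup>2) \<partial>\<mu> \<partial>sphere_uniform)
      + 2 * (\<integral>\<^sup>+\<theta>. \<integral>\<^sup>+x. ennreal ((x \<bullet> \<theta>)\<^sup>2) \<partial>\<nu> \<partial>sphere_uniform)"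
    by (subst nn_integral_add; (subst nn_integral_cmult)?; (subst nn_integral_cmult)?) measurable
  also have "\<dots> < \<infinity>"
    using le_less_trans[OF nn_integral_sphere_uniform_proj_le P2_D(3)] \<mu> \<nu>
    by (auto simp: ennreal_mult_less_top)
  finally show ?thesis
    unfolding SW by simp
qed

lemma SW_nonneg: "0 \<le> SW \<mu> \<nu>"
  unfolding SW_def set_lebesgue_integral_def by (auto intro!: integral_nonneg)

lemma SW_triangle:
  fixes \<mu> \<nu> \<rho> :: "'a::euclidean_space measure"
  assumes \<mu>: "\<mu> \<in> P2" and \<nu>: "\<nu> \<in> P2" and \<rho>: "\<rho> \<in> P2"
  shows "SW \<mu> \<rho> \<le> SW \<mu> \<nu> + SW \<nu> \<rho>"
proof -
  have SW: "(\<integral>\<^sup>+\<theta>. ennreal ((wasserstein2 (proj_measure \<theta> \<mu>) (proj_measure \<theta> \<nu>))\<^sup>2) \<partial>sphere_uniform)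
      = ennreal ((SW \<mu> \<nu>)\<^sup>2)" if "\<mu> \<in> P2" "\<nu> \<in> P2" for \<mu> \<nu> :: "'a measure"
    by (simp add: ennreal_wasserstein2_proj ennreal_SW_square that)
  have "ennreal ((SW \<mu> \<rho>)\<^sup>2) \<le> ennreal ((SW \<mu> \<nu> + SW \<nu> \<rho>)\<^sup>2)"
    unfolding SW[OF \<mu> \<rho>, symmetric]
    by (rule nn_integral_square_triangle[OF _ _ _ SW[OF \<mu> \<nu>, THEN eq_refl] SW[OF \<nu> \<rho>, THEN eq_refl] SW_nonneg SW_nonneg])
      (use measurable_wasserstein2_proj assms in
        \<open>auto simp: wasserstein2_nonneg wasserstein2_proj_triangle borel_measurable_sphere_uniform\<close>)
  then have "(SW \<mu> \<rho>)\<^sup>2 \<le> (SW \<mu> \<nu> + SW \<nu> \<rho>)\<^sup>2"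
    by simp
  then show ?thesis
    by (rule power2_le_imp_le) (simp add: SW_nonneg)
qed

section \<open>Symmetry and definiteness\<close>

lemma wasserstein2_commute: "wasserstein2 \<mu> \<nu> = wasserstein2 \<nu> \<mu>"
proof -
  have "\<exists>\<gamma>'\<in>couplings \<nu> \<mu>. (\<integral>\<^sup>+ (x, y). ennreal ((dist x y)\<^sup>2) \<partial>\<gamma>') = (\<integral>\<^sup>+ (x, y). ennreal ((dist x y)\<^sup>2) \<partial>\<gamma>)"
    if \<gamma>: "\<gamma> \<in> couplings \<mu> \<nu>" for \<gamma> and \<mu> \<nu> :: "'a measure"
  proof -
    have s: "sets \<gamma> = sets (borel \<Otimes>\<^sub>M borel)" and p: "prob_space \<gamma>"
      and d: "distr \<gamma> borel fst = \<mu>" "distr \<gamma> borel snd = \<nu>"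
      using \<gamma> by (auto simp: couplings_def)
    have sw: "(\<lambda>(x, y). (y, x)) \<in> \<gamma> \<rightarrow>\<^sub>M borel \<Otimes>\<^sub>M borel"
      unfolding measurable_cong_sets[OF s refl] by measurable
    let ?g = "distr \<gamma> (borel \<Otimes>\<^sub>M borel) (\<lambda>(x, y). (y, x))"
    have "?g \<in> couplings \<nu> \<mu>"
      using prob_space.prob_space_distr[OF p sw] d
      by (auto simp: couplings_def distr_distr[OF _ sw] comp_def case_prod_beta)
    moreover have "(\<integral>\<^sup>+ (x, y). ennreal ((dist x y)\<^sup>2) \<partial>?g) = (\<integral>\<^sup>+ (x, y). ennreal ((dist x y)\<^sup>2) \<partial>\<gamma>)"
      by (subst nn_integral_distr[OF sw]) (auto simp: dist_commute intro!: nn_integral_cong)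
    ultimately show ?thesis by blast
  qed
  then have "(INF \<gamma> \<in> couplings \<mu> \<nu>. \<integral>\<^sup>+ (x, y). ennreal ((dist x y)\<^sup>2) \<partial>\<gamma>)
      = (INF \<gamma> \<in> couplings \<nu> \<mu>. \<integral>\<^sup>+ (x, y). ennreal ((dist x y)\<^sup>2) \<partial>\<gamma>)"
    by (intro antisym INF_mono) (metis order_refl)+
  then show ?thesis by (simp add: wasserstein2_def)
qed

lemma SW_commute: "SW \<mu> \<nu> = SW \<nu> \<mu>"
  unfolding SW_def by (simp only: wasserstein2_commute[of "proj_measure _ \<mu>" "proj_measure _ \<nu>"])

text \<open>The cone over a set of directions of full measure is dense.\<close>

lemma AE_sphere_uniform_imp_UNIV:
  fixes D :: "'a::euclidean_space set"
  assumes AE: "AE \<theta> in sphere_uniform. P \<theta>" and [measurable]: "{\<theta>. P \<theta>} \<in> sets borel"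
    and D: "closed D" "\<And>\<theta> r. P \<theta> \<Longrightarrow> r *\<^sub>R \<theta> \<in> D"
  shows "D = UNIV"
proof -
  have [measurable]: "(\<lambda>\<theta>. P \<theta>) \<in> measurable borel (count_space UNIV)"
    using assms(2) by (simp add: pred_def)
  have "AE x in uniform_measure lborel (ball (0::'a) 1). P (sgn x)"
    using AE unfolding sphere_uniform_def by (subst (asm) AE_distr_iff) auto
  moreover have "emeasure lborel (ball (0::'a) 1) \<noteq> 0"
    using content_ball_pos[of 1 "0::'a"] by (auto simp: measure_def)
  moreover have "emeasure lborel (ball (0::'a) 1) < \<infinity>"
    using emeasure_lborel_ball_finite[of "0::'a" 1] by simp
  ultimately have ae: "AE x in lborel. x \<in> ball (0::'a) 1 \<longrightarrow> P (sgn x)"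
    by (simp add: AE_uniform_measure)
  have "x \<in> D" for x
  proof (rule ccontr)
    assume x: "x \<notin> D"
    \<comment> \<open>Dividing by \<open>c\<close> moves \<open>x\<close> into the unit ball, where
      the almost everywhere statement is available. \<open>S\<close> is an open neighbourhood of
      \<open>x /\<^sub>R c\<close> whose points are scaled to points outside
      \<open>D\<close>.\<close>
    define c where "c = norm x + 1"
    have c: "c > 0" "norm x < c" by (auto simp: c_def add_nonneg_pos)
    define S where "S = (\<lambda>y. c *\<^sub>R y) -` (- D) \<inter> ball 0 1"
    have "open S"
      unfolding S_def using D(1) by (intro open_Int open_vimage open_Compl continuous_intros) auto
    moreover have "x /\<^sub>R c \<in> S"
      using x c by (simp add: S_def field_simps)
    ultimately have "\<not> negligible S"
      using open_not_negligible by blast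
    moreover have "AE y in lborel. y \<notin> S"
      using ae
    proof eventually_elim
      case (elim y)
      have "c *\<^sub>R y = (c * norm y) *\<^sub>R sgn y"
        by (cases "y = 0") (simp_all add: sgn_div_norm)
      with elim D(2) show ?case by (auto simp: S_def)
    qed
    then have "S \<in> null_sets lborel"
      using \<open>open S\<close> by (simp add: AE_iff_null_sets)
    ultimately show False
      by (simp add: negligible_iff_null_sets null_sets_completionI)
  qed
  then show ?thesis by auto
qed

lemma proj_measure_eq_if_proj_cost_eq_0:
  assumes \<mu>: "\<mu> \<in> P2" and \<nu>: "\<nu> \<in> P2" and "proj_cost \<mu> \<nu> \<theta> = 0"
  shows "proj_measure \<theta> \<mu> = proj_measure \<theta> \<nu>"
proof -
  note rd = real_distribution_proj_measure[OF \<mu>, of \<theta>] real_distribution_proj_measure[OF \<nu>, of \<theta>]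
  note m [measurable] = measurable_quantile[OF rd(1)] measurable_quantile[OF rd(2)]
  have "AE u in unit_lebesgue. quantile (proj_measure \<theta> \<mu>) u = quantile (proj_measure \<theta> \<nu>) u"
    using assms(3) unfolding cdf_cost_eq_quantile[OF rd]
    by (subst (asm) nn_integral_0_iff_AE) auto
  then have "distr unit_lebesgue borel (quantile (proj_measure \<theta> \<mu>)) = distr unit_lebesgue borel (quantile (proj_measure \<theta> \<nu>))"
    using m by (intro distr_cong_AE) auto
  then show ?thesis by (simp add: distr_quantile rd)
qed

text \<open>A Cramer-Wold argument for almost all directions: the frequencies at which the cosine
  integrals agree form a closed set, by dominated convergence, and contain every multiple of a
  direction with equal projections. Closedness fills in the exceptional null set.\<close>

lemma SW_eq_0_imp_eq:
  fixes \<mu> \<nu> :: "'a::euclidean_space measure"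
  assumes \<mu>: "\<mu> \<in> P2" and \<nu>: "\<nu> \<in> P2" and "SW \<mu> \<nu> = 0"
  shows "\<mu> = \<nu>"
proof -
  note [measurable] = measurable_proj_cost[OF \<mu> \<nu>]
  have "AE \<theta> in sphere_uniform. proj_cost \<mu> \<nu> \<theta> = 0"
    using assms(3) ennreal_SW_square[OF \<mu> \<nu>]
    by (subst nn_integral_0_iff_AE[symmetric])
      (simp_all add: borel_measurable_sphere_uniform measurable_proj_cost \<mu> \<nu>)
  define D where "D = {\<xi>. \<forall>a. (\<integral>x. cos (\<xi> \<bullet> x + a) \<partial>\<mu>) = (\<integral>x. cos (\<xi> \<bullet> x + a) \<partial>\<nu>)}"
  have cont: "continuous_on UNIV (\<lambda>\<xi>. \<integral>x. cos (\<xi> \<bullet> x + a) \<partial>\<rho>)" if \<rho>: "\<rho> \<in> P2" for \<rho> :: "'a measure" and a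
    unfolding continuous_on_sequentially comp_def
  proof (intro allI ballI impI, elim conjE)
    fix X :: "nat \<Rightarrow> 'a" and \<xi> assume X: "X \<longlonglongrightarrow> \<xi>"
    interpret prob_space \<rho> by (rule P2_D[OF \<rho>])
    have [measurable_cong]: "sets \<rho> = sets borel" by (rule P2_D[OF \<rho>])
    show "(\<lambda>n. \<integral>x. cos (X n \<bullet> x + a) \<partial>\<rho>) \<longlonglongrightarrow> (\<integral>x. cos (\<xi> \<bullet> x + a) \<partial>\<rho>)"
      by (rule integral_dominated_convergence[where w = "\<lambda>_. 1"]) (auto intro!: tendsto_intros X)
  qed
  have "D = UNIV"
  proof (rule AE_sphere_uniform_imp_UNIV)
    show "AE \<theta> in sphere_uniform. proj_cost \<mu> \<nu> \<theta> = 0" by fact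
    show "{\<theta>. proj_cost \<mu> \<nu> \<theta> = 0} \<in> sets borel" by measurable
    show "closed D"
      unfolding D_def by (intro closed_Collect_all closed_Collect_eq cont \<mu> \<nu>)
    fix \<theta> :: 'a and r :: real assume "proj_cost \<mu> \<nu> \<theta> = 0"
    then have eq: "proj_measure \<theta> \<mu> = proj_measure \<theta> \<nu>"
      by (rule proj_measure_eq_if_proj_cost_eq_0[OF \<mu> \<nu>])
    have "(\<integral>x. cos (r *\<^sub>R \<theta> \<bullet> x + a) \<partial>\<rho>) = (\<integral>y. cos (r * y + a) \<partial>proj_measure \<theta> \<rho>)" if \<rho>: "\<rho> \<in> P2" for \<rho> a
      unfolding proj_measure_def
      by (subst integral_distr) (auto intro!: measurable_P2[OF \<rho>] simp: inner_commute)
    with eq \<mu> \<nu> show "r *\<^sub>R \<theta> \<in> D" by (simp add: D_def)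
  qed
  then show ?thesis
    by (intro measure_eqI_cos P2_D \<mu> \<nu>) (auto simp: D_def)
qed

lemma SW_self:
  assumes \<mu>: "\<mu> \<in> P2"
  shows "SW \<mu> \<mu> = 0"
proof -
  have "proj_cost \<mu> \<mu> \<theta> = 0" for \<theta>
    by (simp add: cdf_cost_eq_quantile real_distribution_proj_measure \<mu>)
  then have "ennreal ((SW \<mu> \<mu>)\<^sup>2) = 0" by (simp add: ennreal_SW_square \<mu>)
  then show ?thesis by simp
qed

lemma Metric_space_SW: "Metric_space P2 (SW :: 'a::euclidean_space measure \<Rightarrow> _)"
  by unfold_locales (auto simp: SW_nonneg SW_self intro: SW_commute SW_eq_0_imp_eq SW_triangle)

section \<open>Control of second moments, lower semicontinuity and completeness\<close>

lemma sphere_uniform_inner_square_lower_bound: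
  obtains c :: real where "c > 0"
    "\<And>x::'a::euclidean_space. ennreal (c * (norm x)\<^sup>2) \<le> (\<integral>\<^sup>+\<theta>. ennreal ((x \<bullet> \<theta>)\<^sup>2) \<partial>sphere_uniform)"
proof -
  interpret prob_space "sphere_uniform :: 'a measure" by (rule prob_space_sphere_uniform)
  let ?g = "\<lambda>x::'a. \<integral>\<theta>. (x \<bullet> \<theta>)\<^sup>2 \<partial>sphere_uniform"
  have bd: "AE \<theta> in sphere_uniform. norm ((x \<bullet> \<theta>)\<^sup>2) \<le> 1" if "x \<in> sphere 0 1" for x :: 'a
    using AE_sphere_uniform
  proof eventually_elim
    case (elim \<theta>)
    with that have "\<bar>x \<bullet> \<theta>\<bar> \<le> 1" using Cauchy_Schwarz_ineq2[of x \<theta>] by simp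
    then show ?case by (simp add: abs_square_le_1)
  qed
  have int: "integrable sphere_uniform (\<lambda>\<theta>. (x \<bullet> \<theta>)\<^sup>2)" if "x \<in> sphere 0 1" for x :: 'a
    using bd[OF that] by (rule integrable_const_bound) measurable
  have "continuous_on (sphere 0 1) ?g"
    unfolding continuous_on_sequentially comp_def
  proof (intro allI ballI impI, elim conjE)
    fix X :: "nat \<Rightarrow> 'a" and x assume "\<forall>n. X n \<in> sphere 0 1" "X \<longlonglongrightarrow> x"
    then show "(\<lambda>n. ?g (X n)) \<longlonglongrightarrow> ?g x"
      using bd by (intro integral_dominated_convergence[where w = "\<lambda>_. 1"]) (auto intro!: tendsto_intros)
  qed
  then obtain x0 :: 'a where x0: "x0 \<in> sphere 0 1" "\<And>x. x \<in> sphere 0 1 \<Longrightarrow> ?g x0 \<le> ?g x"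
    using continuous_attains_inf[of "sphere 0 1" ?g] by auto
  \<comment> \<open>The constant is the minimum over unit vectors, which compactness provides. A
    minimum 0 would confine almost all directions to a hyperplane, against the density of the cone
    over them.\<close>
  have "?g x0 \<noteq> 0"
  proof
    assume "?g x0 = 0"
    then have "AE \<theta> in sphere_uniform. x0 \<bullet> \<theta> = 0"
      using integral_nonneg_eq_0_iff_AE[OF int[OF x0(1)]] by simp
    then have "{x. x0 \<bullet> x = 0} = UNIV"
      by (rule AE_sphere_uniform_imp_UNIV) (auto intro!: closed_Collect_eq continuous_intros)
    then have "x0 \<bullet> x0 = 0" by blast
    with x0(1) show False by simp
  qed
  moreover have "?g x0 \<ge> 0" by simp
  ultimately have pos: "?g x0 > 0" by linarith
  show thesis
  proof (rule that[OF pos])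
    fix x :: 'a
    show "ennreal (?g x0 * (norm x)\<^sup>2) \<le> (\<integral>\<^sup>+\<theta>. ennreal ((x \<bullet> \<theta>)\<^sup>2) \<partial>sphere_uniform)"
    proof (cases "x = 0")
      case False
      let ?u = "sgn x"
      have u: "?u \<in> sphere 0 1" using False by (simp add: norm_sgn)
      have "ennreal (?g x0 * (norm x)\<^sup>2) \<le> ennreal ((norm x)\<^sup>2) * ennreal (?g ?u)"
        using x0(2)[OF u] by (simp flip: ennreal_mult add: mult.commute mult_left_mono ennreal_leI)
      also have "ennreal (?g ?u) = (\<integral>\<^sup>+\<theta>. ennreal ((?u \<bullet> \<theta>)\<^sup>2) \<partial>sphere_uniform)"
        by (rule nn_integral_eq_integral[OF int[OF u], symmetric]) simp
      also have "ennreal ((norm x)\<^sup>2) * \<dots> = (\<integral>\<^sup>+\<theta>. ennreal ((norm x)\<^sup>2) * ennreal ((?u \<bullet> \<theta>)\<^sup>2) \<partial>sphere_uniform)"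
        by (rule nn_integral_cmult[symmetric]) measurable
      also have "\<dots> = (\<integral>\<^sup>+\<theta>. ennreal ((x \<bullet> \<theta>)\<^sup>2) \<partial>sphere_uniform)"
      proof (intro nn_integral_cong)
        fix \<theta> :: 'a
        have "norm x *\<^sub>R ?u = x" using False by (simp add: sgn_div_norm)
        then have "norm x * (?u \<bullet> \<theta>) = x \<bullet> \<theta>" by (metis inner_scaleR_left)
        then show "ennreal ((norm x)\<^sup>2) * ennreal ((?u \<bullet> \<theta>)\<^sup>2) = ennreal ((x \<bullet> \<theta>)\<^sup>2)"
          by (simp flip: ennreal_mult power_mult_distrib)
      qed
      finally show ?thesis .
    qed simp
  qed
qed

text \<open>The projected inequality averaged over the sphere. One fixed \<open>\<nu>\<close>
  controls the second moments of all \<open>\<mu>\<close> within a bounded distance.\<close>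

lemma second_moment_le_SW:
  obtains c :: real where "c > 0"
    "\<And>\<mu> \<nu> :: 'a::euclidean_space measure. \<mu> \<in> P2 \<Longrightarrow> \<nu> \<in> P2 \<Longrightarrow>
      ennreal c * (\<integral>\<^sup>+x. ennreal ((norm x)\<^sup>2) \<partial>\<mu>)
        \<le> 2 * ennreal ((SW \<mu> \<nu>)\<^sup>2) + 2 * (\<integral>\<^sup>+x. ennreal ((norm x)\<^sup>2) \<partial>\<nu>)"
proof -
  obtain c :: real where c: "c > 0"
    "\<And>x::'a. ennreal (c * (norm x)\<^sup>2) \<le> (\<integral>\<^sup>+\<theta>. ennreal ((x \<bullet> \<theta>)\<^sup>2) \<partial>sphere_uniform)"
    using sphere_uniform_inner_square_lower_bound by blast
  show thesis
  proof (rule that[OF c(1)])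
    fix \<mu> \<nu> :: "'a measure" assume \<mu>: "\<mu> \<in> P2" and \<nu>: "\<nu> \<in> P2"
    have [measurable_cong]: "sets \<mu> = sets borel" "sets \<nu> = sets borel"
      using \<mu> \<nu> by (auto dest: P2_D)
    interpret m: prob_space \<mu> by (rule P2_D[OF \<mu>])
    interpret n: prob_space \<nu> by (rule P2_D[OF \<nu>])
    interpret s: prob_space "sphere_uniform :: 'a measure" by (rule prob_space_sphere_uniform)
    interpret pair_sigma_finite \<mu> "sphere_uniform :: 'a measure" ..
    note [measurable] = measurable_proj_cost[OF \<mu> \<nu>]
    have "ennreal c * (\<integral>\<^sup>+x. ennreal ((norm x)\<^sup>2) \<partial>\<mu>) = (\<integral>\<^sup>+x. ennreal (c * (norm x)\<^sup>2) \<partial>\<mu>)"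
      using c(1) by (subst nn_integral_cmult[symmetric]) (auto simp: ennreal_mult)
    also have "\<dots> \<le> (\<integral>\<^sup>+x. \<integral>\<^sup>+\<theta>. ennreal ((x \<bullet> \<theta>)\<^sup>2) \<partial>sphere_uniform \<partial>\<mu>)"
      by (intro nn_integral_mono c(2))
    also have "\<dots> = (\<integral>\<^sup>+\<theta>. \<integral>\<^sup>+x. ennreal ((x \<bullet> \<theta>)\<^sup>2) \<partial>\<mu> \<partial>sphere_uniform)"
      by (rule Fubini'[symmetric]) measurable
    also have "\<dots> \<le> (\<integral>\<^sup>+\<theta>. 2 * proj_cost \<mu> \<nu> \<theta> + 2 * (\<integral>\<^sup>+x. ennreal ((x \<bullet> \<theta>)\<^sup>2) \<partial>\<nu>) \<partial>sphere_uniform)"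
      by (intro nn_integral_mono second_moment_proj_le \<mu> \<nu>)
    also have "\<dots> = 2 * (\<integral>\<^sup>+\<theta>. proj_cost \<mu> \<nu> \<theta> \<partial>sphere_uniform)
        + 2 * (\<integral>\<^sup>+\<theta>. \<integral>\<^sup>+x. ennreal ((x \<bullet> \<theta>)\<^sup>2) \<partial>\<nu> \<partial>sphere_uniform)"
      by (subst nn_integral_add; (subst nn_integral_cmult)?; (subst nn_integral_cmult)?) measurable
    also have "\<dots> \<le> 2 * ennreal ((SW \<mu> \<nu>)\<^sup>2) + 2 * (\<integral>\<^sup>+x. ennreal ((norm x)\<^sup>2) \<partial>\<nu>)"
      unfolding ennreal_SW_square[OF \<mu> \<nu>]
      by (intro add_left_mono mult_left_mono nn_integral_sphere_uniform_proj_le \<nu>) simp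
    finally show "ennreal c * (\<integral>\<^sup>+x. ennreal ((norm x)\<^sup>2) \<partial>\<mu>)
        \<le> 2 * ennreal ((SW \<mu> \<nu>)\<^sup>2) + 2 * (\<integral>\<^sup>+x. ennreal ((norm x)\<^sup>2) \<partial>\<nu>)" .
  qed
qed

lemma weak_conv_m_distr:
  fixes X :: "nat \<Rightarrow> 'b \<Rightarrow> real"
  assumes "prob_space \<Omega>" and [measurable]: "\<And>n. X n \<in> borel_measurable \<Omega>" "X' \<in> borel_measurable \<Omega>"
    and lim: "AE \<omega> in \<Omega>. (\<lambda>n. X n \<omega>) \<longlonglongrightarrow> X' \<omega>"
  shows "weak_conv_m (\<lambda>n. distr \<Omega> borel (X n)) (distr \<Omega> borel X')"
proof (rule integral_bdd_continuous_conv_imp_weak_conv)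
  interpret prob_space \<Omega> by fact
  show "real_distribution (distr \<Omega> borel (X n))" "real_distribution (distr \<Omega> borel X')" for n
    by (intro real_distribution_distr; measurable)+
  fix f :: "real \<Rightarrow> real" assume f: "\<And>x. isCont f x" "\<And>x. \<bar>f x\<bar> \<le> 1"
  have [measurable]: "f \<in> borel_measurable borel"
    using f(1) by (intro borel_measurable_continuous_onI continuous_at_imp_continuous_on) auto
  have "(\<lambda>n. \<integral>\<omega>. f (X n \<omega>) \<partial>\<Omega>) \<longlonglongrightarrow> (\<integral>\<omega>. f (X' \<omega>) \<partial>\<Omega>)"
  proof (rule integral_dominated_convergence[where w = "\<lambda>_. 1"])
    show "AE \<omega> in \<Omega>. (\<lambda>n. f (X n \<omega>)) \<longlonglongrightarrow> f (X' \<omega>)"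
      using lim by eventually_elim (rule isCont_tendsto_compose[OF f(1)])
  qed (use f(2) in auto)
  then show "(\<lambda>n. integral\<^sup>L (distr \<Omega> borel (X n)) f) \<longlonglongrightarrow> integral\<^sup>L (distr \<Omega> borel X') f"
    by (simp add: integral_distr)
qed

text \<open>The limit is the law of the almost sure limit, and Fatou keeps its second moment finite.
  One subsequence and one probability space serve all directions and all \<open>\<nu>\<close>, so
  \<open>\<nu>\<close> may still be chosen after the limit is fixed.\<close>

lemma bounded_second_moment_imp_SW_lower_semicontinuous:
  fixes \<mu> :: "nat \<Rightarrow> 'a::euclidean_space measure"
  assumes \<mu>: "\<And>n. \<mu> n \<in> P2"
    and C: "\<And>n. (\<integral>\<^sup>+x. ennreal ((norm x)\<^sup>2) \<partial>\<mu> n) \<le> C" "C < \<infinity>"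
  obtains r \<mu>' where "strict_mono r" "\<mu>' \<in> P2"
    "\<And>\<nu>. \<nu> \<in> P2 \<Longrightarrow> ennreal ((SW \<nu> \<mu>')\<^sup>2) \<le> liminf (\<lambda>n. ennreal ((SW \<nu> (\<mu> (r n)))\<^sup>2))"
proof -
  obtain r :: "nat \<Rightarrow> nat" and \<Omega> :: "real measure" and X :: "nat \<Rightarrow> real \<Rightarrow> 'a" and X' :: "real \<Rightarrow> 'a"
    where r: "strict_mono r" and O: "prob_space \<Omega>"
      and m [measurable]: "\<And>n. X n \<in> borel_measurable \<Omega>" "X' \<in> borel_measurable \<Omega>"
      and d: "\<And>n. distr \<Omega> borel (X n) = \<mu> (r n)" and lim: "AE \<omega> in \<Omega>. (\<lambda>n. X n \<omega>) \<longlonglongrightarrow> X' \<omega>"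
    by (rule bounded_second_moment_imp_AE_convergent_representation[OF P2_D(1)[OF \<mu>] P2_D(2)[OF \<mu>] C])
      (rule that)
  interpret prob_space \<Omega> by (rule O)
  define \<mu>' where "\<mu>' = distr \<Omega> borel X'"
  have "(\<integral>\<^sup>+x. ennreal ((norm x)\<^sup>2) \<partial>\<mu>') = (\<integral>\<^sup>+\<omega>. ennreal ((norm (X' \<omega>))\<^sup>2) \<partial>\<Omega>)"
    unfolding \<mu>'_def by (rule nn_integral_distr) measurable
  also have "\<dots> = (\<integral>\<^sup>+\<omega>. liminf (\<lambda>n. ennreal ((norm (X n \<omega>))\<^sup>2)) \<partial>\<Omega>)"
  proof (rule nn_integral_cong_AE)
    show "AE \<omega> in \<Omega>. ennreal ((norm (X' \<omega>))\<^sup>2) = liminf (\<lambda>n. ennreal ((norm (X n \<omega>))\<^sup>2))"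
      using lim by eventually_elim
        (auto intro!: lim_imp_Liminf[symmetric] tendsto_intros)
  qed
  also have "\<dots> \<le> liminf (\<lambda>n. \<integral>\<^sup>+\<omega>. ennreal ((norm (X n \<omega>))\<^sup>2) \<partial>\<Omega>)"
    by (rule nn_integral_liminf) measurable
  also have "\<dots> = liminf (\<lambda>n. \<integral>\<^sup>+x. ennreal ((norm x)\<^sup>2) \<partial>\<mu> (r n))"
    by (simp add: d[symmetric] nn_integral_distr)
  also have "\<dots> \<le> liminf (\<lambda>n. C)"
    by (intro Liminf_mono always_eventually allI C)
  also have "\<dots> < \<infinity>"
    using C(2) by (simp add: Liminf_const)
  finally have \<mu>': "\<mu>' \<in> P2"
    by (simp add: P2_def \<mu>'_def prob_space_distr)
  have "ennreal ((SW \<nu> \<mu>')\<^sup>2) \<le> liminf (\<lambda>n. ennreal ((SW \<nu> (\<mu> (r n)))\<^sup>2))" if \<nu>: "\<nu> \<in> P2" for \<nu>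
  proof -
    have "proj_cost \<nu> \<mu>' \<theta> \<le> liminf (\<lambda>n. proj_cost \<nu> (\<mu> (r n)) \<theta>)" for \<theta>
    proof (rule cdf_cost_le_liminf)
      have "weak_conv_m (\<lambda>n. distr \<Omega> borel (\<lambda>\<omega>. X n \<omega> \<bullet> \<theta>)) (distr \<Omega> borel (\<lambda>\<omega>. X' \<omega> \<bullet> \<theta>))"
        using lim by (intro weak_conv_m_distr O) (auto elim!: eventually_mono intro!: tendsto_intros)
      moreover have "distr \<Omega> borel (\<lambda>\<omega>. X n \<omega> \<bullet> \<theta>) = proj_measure \<theta> (\<mu> (r n))" for n
        unfolding proj_measure_def d[symmetric] by (subst distr_distr) (auto simp: comp_def)
      moreover have "distr \<Omega> borel (\<lambda>\<omega>. X' \<omega> \<bullet> \<theta>) = proj_measure \<theta> \<mu>'"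
        unfolding proj_measure_def \<mu>'_def by (subst distr_distr) (auto simp: comp_def)
      ultimately show "weak_conv_m (\<lambda>n. proj_measure \<theta> (\<mu> (r n))) (proj_measure \<theta> \<mu>')"
        by simp
    qed (intro real_distribution_proj_measure \<mu> \<mu>' \<nu>)+
    then have "ennreal ((SW \<nu> \<mu>')\<^sup>2) \<le> (\<integral>\<^sup>+\<theta>. liminf (\<lambda>n. proj_cost \<nu> (\<mu> (r n)) \<theta>) \<partial>sphere_uniform)"
      unfolding ennreal_SW_square[OF \<nu> \<mu>'] by (intro nn_integral_mono)
    also have "\<dots> \<le> liminf (\<lambda>n. \<integral>\<^sup>+\<theta>. proj_cost \<nu> (\<mu> (r n)) \<theta> \<partial>sphere_uniform)"
      using measurable_proj_cost[OF \<nu> \<mu>]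
      by (intro nn_integral_liminf) (simp add: borel_measurable_sphere_uniform)
    finally show ?thesis
      by (simp add: ennreal_SW_square \<nu> \<mu>)
  qed
  with that[OF r \<mu>'] show thesis by blast
qed

lemma mcomplete_SW: "Metric_space.mcomplete P2 (SW :: 'a::euclidean_space measure \<Rightarrow> _)"
proof -
  interpret Metric_space P2 "SW :: 'a measure \<Rightarrow> _" by (rule Metric_space_SW)
  show ?thesis
    unfolding mcomplete_def
  proof (intro allI impI)
    fix \<sigma> :: "nat \<Rightarrow> 'a measure" assume "MCauchy \<sigma>"
    then have \<sigma>: "\<And>n. \<sigma> n \<in> P2"
      and cauchy: "\<And>\<epsilon>. \<epsilon> > 0 \<Longrightarrow> \<exists>N. \<forall>n n'. N \<le> n \<longrightarrow> N \<le> n' \<longrightarrow> SW (\<sigma> n) (\<sigma> n') < \<epsilon>"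
      by (auto simp: MCauchy_def)
    obtain N where N: "\<And>n n'. N \<le> n \<Longrightarrow> N \<le> n' \<Longrightarrow> SW (\<sigma> n) (\<sigma> n') < 1"
      using cauchy[of 1] by auto
    obtain c :: real where c: "c > 0"
      "\<And>\<mu> \<nu> :: 'a measure. \<mu> \<in> P2 \<Longrightarrow> \<nu> \<in> P2 \<Longrightarrow>
        ennreal c * (\<integral>\<^sup>+x. ennreal ((norm x)\<^sup>2) \<partial>\<mu>)
          \<le> 2 * ennreal ((SW \<mu> \<nu>)\<^sup>2) + 2 * (\<integral>\<^sup>+x. ennreal ((norm x)\<^sup>2) \<partial>\<nu>)"
      using second_moment_le_SW by blast
    \<comment> \<open>The summand 2 bounds twice the squared distance to \<open>\<sigma> N\<close>,
      which is below 1 from index \<open>N\<close> on; hence the shift of the sequence by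
      \<open>N\<close>.\<close>
    define C where "C = ennreal (1 / c) * (2 + 2 * (\<integral>\<^sup>+x. ennreal ((norm x)\<^sup>2) \<partial>\<sigma> N))"
    have "(\<integral>\<^sup>+x. ennreal ((norm x)\<^sup>2) \<partial>\<sigma> (n + N)) \<le> C" for n
    proof -
      have "(SW (\<sigma> (n + N)) (\<sigma> N))\<^sup>2 \<le> 1"
        using N[of "n + N" N] SW_nonneg by (simp add: abs_square_le_1)
      then have "2 * ennreal ((SW (\<sigma> (n + N)) (\<sigma> N))\<^sup>2) \<le> 2 * 1"
        by (intro mult_left_mono) auto
      with c(2)[OF \<sigma> \<sigma>, of "n + N" N]
      have "ennreal c * (\<integral>\<^sup>+x. ennreal ((norm x)\<^sup>2) \<partial>\<sigma> (n + N)) \<le> 2 + 2 * (\<integral>\<^sup>+x. ennreal ((norm x)\<^sup>2) \<partial>\<sigma> N)"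
        by (auto intro: order_trans add_right_mono)
      then have "ennreal (1 / c) * (ennreal c * (\<integral>\<^sup>+x. ennreal ((norm x)\<^sup>2) \<partial>\<sigma> (n + N))) \<le> C"
        unfolding C_def by (rule mult_left_mono) simp
      then show ?thesis
        using c(1) by (simp flip: mult.assoc ennreal_mult)
    qed
    moreover have "C < \<infinity>"
      using P2_D(3)[OF \<sigma>] by (simp add: C_def ennreal_mult_less_top)
    ultimately obtain r :: "nat \<Rightarrow> nat" and \<mu>' where r: "strict_mono r" and \<mu>': "\<mu>' \<in> P2"
      and lsc: "\<And>\<nu>. \<nu> \<in> P2 \<Longrightarrow> ennreal ((SW \<nu> \<mu>')\<^sup>2) \<le> liminf (\<lambda>n. ennreal ((SW \<nu> (\<sigma> (r n + N)))\<^sup>2))"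
      using bounded_second_moment_imp_SW_lower_semicontinuous[of "\<lambda>n. \<sigma> (n + N)" C] \<sigma> by auto
    have "limitin mtopology \<sigma> \<mu>' sequentially"
      unfolding limit_metric_sequentially
    proof (intro conjI allI impI \<mu>')
      fix \<epsilon> :: real assume e: "\<epsilon> > 0"
      then obtain K where K: "\<And>n n'. K \<le> n \<Longrightarrow> K \<le> n' \<Longrightarrow> SW (\<sigma> n) (\<sigma> n') < \<epsilon> / 2"
        using cauchy[of "\<epsilon> / 2"] by auto
      have "SW (\<sigma> n) \<mu>' < \<epsilon>" if n: "K \<le> n" for n
      proof -
        \<comment> \<open>With \<open>\<nu>\<close> taken to be \<open>\<sigma> n\<close>, the
          distance to the limit is bounded by distances to late members of the subsequence, all
          below \<open>\<epsilon> / 2\<close>; this gives convergence of the whole sequence at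
          once.\<close>
        have "ennreal ((SW (\<sigma> n) \<mu>')\<^sup>2) \<le> liminf (\<lambda>j. ennreal ((SW (\<sigma> n) (\<sigma> (r j + N)))\<^sup>2))"
          by (rule lsc[OF \<sigma>])
        also have "\<dots> \<le> limsup (\<lambda>j. ennreal ((SW (\<sigma> n) (\<sigma> (r j + N)))\<^sup>2))"
          by (rule Liminf_le_Limsup) simp
        also have "\<dots> \<le> ennreal ((\<epsilon> / 2)\<^sup>2)"
        proof (rule Limsup_bounded)
          show "\<forall>\<^sub>F j in sequentially. ennreal ((SW (\<sigma> n) (\<sigma> (r j + N)))\<^sup>2) \<le> ennreal ((\<epsilon> / 2)\<^sup>2)"
            using eventually_ge_at_top[of K]
          proof eventually_elim
            case (elim j)
            then have "K \<le> r j + N" using seq_suble[OF r, of j] by linarith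
            then show ?case
              using K[OF n] SW_nonneg by (intro ennreal_leI power_mono) (auto simp: less_imp_le)
          qed
        qed
        finally have "(SW (\<sigma> n) \<mu>')\<^sup>2 \<le> (\<epsilon> / 2)\<^sup>2" by simp
        then have "SW (\<sigma> n) \<mu>' \<le> \<epsilon> / 2"
          by (rule power2_le_imp_le) (use e in simp)
        then show ?thesis using e by simp
      qed
      then show "\<exists>K. \<forall>n\<ge>K. \<sigma> n \<in> P2 \<and> SW (\<sigma> n) \<mu>' < \<epsilon>"
        using \<sigma> by blast
    qed
    then show "\<exists>x. limitin mtopology \<sigma> x sequentially" ..
  qed
qed

theorem proposition2p4:
  assumes "CARD('n::finite) \<ge> 2"
  shows "Metric_space (P2 :: (real ^ 'n) measure set) SW \<and>
         Metric_space.mcomplete (P2 :: (real ^ 'n) measure set) SW"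
  by (intro conjI Metric_space_SW mcomplete_SW)

end
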